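(* Let $\mathbb{A}$ be a finite dimensional nontrivial associative real $^*$-algebra with unit, with $\mathbb{S}_{\mathbb{A}}\ne\varnothing$ and with a complete submultiplicative norm $|\cdot|$ such that $|q|^2=qq^c$ for all $q\in Q_{\mathbb{A}}$, and let $X$ be a Banach two-sided $\mathbb{A}$-module. Let $m\in\mathbb{N}$ (possibly $m=0$) and let $P(\mathrm{x})=\sum_{k=0}^{m+2}\mathrm{x}^k a_k\in\mathbb{R}[\mathrm{x}]$ with $a_{m+2}\neq 0$. Let $\lambda_1,\dots,\lambda_h\in\mathbb{C}$ be the distinct complex roots of $P$, with multiplicities $m_1,\dots,m_h$, and set $r_P:=\min\{\Re(\lambda_1),\dots,\Re(\lambda_h)\}$. Let $g_P\in C^\infty([0,\infty);\mathbb{R})$ be the unique solution of $$\sum_{k=0}^{m+2}(-1)^k a_k\, g^{(k)}=0 \text{ on } [0,\infty),\qquad g(0)=g'(0)=\dots=g^{(m)}(0)=0,\qquad g^{(m+1)}(0)=(-1)^m (a_{m+2})^{-1}.$$ Let $\mathsf{T}:[0,\infty)\to\mathscr{L}^r(X)$ be a strongly continuous right linear semigroup, let $\mathsf{A}:D(\mathsf{A})\to X$ be its generator, and let $\omega\in\mathbb{R}$ be such that $M:=\sup_{t\in[0,\infty)}\|\mathsf{T}(t)\|e^{-\omega t}<\infty$. If $r_P>\omega$, then the operator $P(\mathsf{A})=\sum_{k=0}^{m+2}\mathsf{A}^ka_k:D(\mathsf{A}^{m+2})\to X$ is bijective, $P(\mathsf{A})^{-1}\in\mathscr{L}^r(X)$,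 and: (a) $P(\mathsf{A})^{-1}=\mathsf{L}(g_P)$, that is, $$P(\mathsf{A})^{-1}x=\int_0^\infty \mathsf{T}(t)g_P(t)x\,dt\qquad\forall x\in X.$$ (b) For every $(p_0,p_1,\dots,p_{m+1})\in\mathbb{A}^{m+2}$, $$\sum_{j=0}^{m+1}\mathsf{A}^jP(\mathsf{A})^{-1}p_jx=\mathsf{L}\left(\sum_{j=0}^{m+1}g_P^{(j)}(-1)^jp_j\right)x\qquad\forall x\in X.$$ Moreover, $$\|P(\mathsf{A})^{-1}\|\le M\sum_{j=1}^h\sum_{k=1}^{m_j}\frac{|c_{-k}^{(j)}|}{(r_P-\omega)^k},$$ where $c_{-k}^{(j)}$ is the residue at $\lambda_j$ of the complex rational function $a_{m+2}(z-\lambda_j)^{k-1}/P(-z)$.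
   Context: A real $^*$-algebra $\mathbb{A}$ is a real algebra with unit $1$ together with an $\mathbb{R}$-linear map $q\mapsto q^c$ such that $(q^c)^c=q$, $(pq)^c=q^cp^c$ and $r^c=r$ for $r\in\mathbb{R}$, where $\mathbb{R}$ is identified with $\mathbb{R}1$. Put $\mathbb{S}_{\mathbb{A}}:=\{q\in\mathbb{A}: q^c=-q,\ q^2=-1\}$, $\mathbb{C}_{\mathbf{j}}:=\{r+s\mathbf{j}: r,s\in\mathbb{R}\}$ for $\mathbf{j}\in\mathbb{S}_{\mathbb{A}}$, and $Q_{\mathbb{A}}:=\bigcup_{\mathbf{j}\in\mathbb{S}_{\mathbb{A}}}\mathbb{C}_{\mathbf{j}}$ (quadratic cone); $qq^c\in\mathbb{R}$ for $q\in Q_{\mathbb{A}}$. Submultiplicative means $|q_1q_2|\le|q_1||q_2|$ for all $q_1,q_2\in\mathbb{A}$. A two-sided $\mathbb{A}$-module $X$ is a commutative group $(X,+)$ with left and right scalar multiplications by $\mathbb{A}$, each distributive in both arguments, with $1x=x=x1$, $p(qx)=(pq)x$, $(xp)q=x(pq)$, $p(xq)=(px)q$ for $p,q\in\mathbb{A}$, and $rx=xr$ for $r\in\mathbb{R}$. It is a Banach two-sided $\mathbb{A}$-module if it has a function $\|\cdot\|:X\to[0,\infty)$ with $\|x\|=0\iff x=0$, $\|x+y\|\le\|x\|+\|y\|$, $\|qx\|\le|q|\|x\|$, $\|xq\|\le|q|\|x\|$, and the metric $\|x-y\|$ is complete. In particular $X$ is a real Banach space, and $X$-valued integrals are Lebesgue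 (Bochner) integrals in it. A right linear operator is an additive map $\mathsf{A}:D(\mathsf{A})\to X$, where $D(\mathsf{A})\subseteq X$ is a right $\mathbb{A}$-submodule (an additive subgroup closed under right multiplication by $\mathbb{A}$), with $\mathsf{A}(xq)=\mathsf{A}(x)q$. $\mathscr{L}^r(X)$ is the set of right linear $\mathsf{B}:X\to X$ with $\|\mathsf{B}\|:=\sup_{x\ne0}\|\mathsf{B}x\|/\|x\|<\infty$. Powers: $\mathsf{A}^0=\mathrm{Id}$ and $D(\mathsf{A}^k)=\{x\in D(\mathsf{A}^{k-1}):\mathsf{A}^{k-1}x\in D(\mathsf{A})\}$. Notation such as $\mathsf{B}px$ means $\mathsf{B}(px)$, where $px$ is left scalar multiplication. A strongly continuous right linear semigroup is a map $\mathsf{T}:[0,\infty)\to\mathscr{L}^r(X)$ such that $t\mapsto\mathsf{T}(t)x$ is continuous for every $x\in X$, $\mathsf{T}(t+s)=\mathsf{T}(t)\mathsf{T}(s)$ for $t,s>0$, and $\mathsf{T}(0)=\mathrm{Id}$. Its generator is $\mathsf{A}x:=\lim_{h\to0^+}\frac1h(\mathsf{T}(h)x-x)$, with $D(\mathsf{A})$ the set of $x\in X$ for which this limit exists in $X$. $L_{\mathsf{T}}([0,\infty);\mathbb{A})$ is the real vector space of continuous $g:[0,\infty)\to\mathbb{A}$ such that $t\mapsto\|\mathsf{T}(t)\||g(t)|$ is Lebesgue integrable on $[0,\infty)$; for such $g$, $\mathsf{L}(g):X\to X$ is $\mathsf{L}(g)x:=\int_0^\infty\mathsf{T}(t)g(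t)x\,dt$.
   Formalization: In the norm estimate, c_{-k}^{(j)} is taken as the residue at -λ_j of (z+λ_j)^{k-1}/P(-z), without the factor a_{m+2}; with the constants as printed the bound fails, e.g. for T=Id on ℂ, ω=0, P=(x-1)(x-2), where the right side is 0. *)

theory Defs
  imports "HOL-Complex_Analysis.Complex_Analysis"
begin

locale real_star_algebra =
  fixes star :: "'a::real_algebra_1 \<Rightarrow> 'a"
  assumes linear_star: "linear star"
    and star_star: "star (star q) = q"
    and star_mult: "star (p * q) = star q * star p"
    and star_of_real: "star (of_real r) = of_real r"

definition imaginary_units :: "('a::real_algebra_1 \<Rightarrow> 'a) \<Rightarrow> 'a set" where
  "imaginary_units star = {q. star q = - q \<and> q\<^sup>2 = - 1}"

definition complex_slice :: "'a::real_algebra_1 \<Rightarrow> 'a set" where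
  "complex_slice j = {of_real r + s *\<^sub>R j | r s. True}"

definition quadratic_cone :: "('a::real_algebra_1 \<Rightarrow> 'a) \<Rightarrow> 'a set" where
  "quadratic_cone star = (\<Union>j\<in>imaginary_units star. complex_slice j)"

text \<open>The real Banach space structure of the module is the one induced by the embedding of
  the reals into the algebra; this is what \<open>lsm_of_real\<close> and \<open>rsm_of_real\<close> say.\<close>

locale banach_two_sided_module =
  fixes lsm :: "'a::{real_normed_algebra, real_algebra_1} \<Rightarrow> 'x::banach \<Rightarrow> 'x"
    and rsm :: "'x \<Rightarrow> 'a \<Rightarrow> 'x"
  assumes lsm_add_right: "lsm q (x + y) = lsm q x + lsm q y"
    and lsm_add_left: "lsm (p + q) x = lsm p x + lsm q x"
    and rsm_add_left: "rsm (x + y) q = rsm x q + rsm y q"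
    and rsm_add_right: "rsm x (p + q) = rsm x p + rsm x q"
    and lsm_one: "lsm 1 x = x"
    and rsm_one: "rsm x 1 = x"
    and lsm_lsm: "lsm p (lsm q x) = lsm (p * q) x"
    and rsm_rsm: "rsm (rsm x p) q = rsm x (p * q)"
    and lsm_rsm: "lsm p (rsm x q) = rsm (lsm p x) q"
    and lsm_of_real: "lsm (of_real r) x = r *\<^sub>R x"
    and rsm_of_real: "rsm x (of_real r) = r *\<^sub>R x"
    and norm_lsm: "norm (lsm q x) \<le> norm q * norm x"
    and norm_rsm: "norm (rsm x q) \<le> norm q * norm x"

text \<open>The set \<open>\<L>\<^sup>r(X)\<close>. Here and in \<^const>\<open>onorm\<close> the quotient at \<open>x = 0\<close>
  is \<open>0 / 0 = 0\<close>, so it does not affect the supremum over \<open>x \<noteq> 0\<close> (and it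
  gives the value \<open>0\<close> when \<open>X = {0}\<close>).\<close>

definition bounded_right_linear ::
    "('x::real_normed_vector \<Rightarrow> 'a \<Rightarrow> 'x) \<Rightarrow> ('x \<Rightarrow> 'x) set" where
  "bounded_right_linear rsm = {B. (\<forall>x y. B (x + y) = B x + B y) \<and>
     (\<forall>x q. B (rsm x q) = rsm (B x) q) \<and>
     bdd_above (range (\<lambda>x. norm (B x) / norm x))}"

text \<open>A partially defined operator is given by its domain \<open>D\<close> and a total function \<open>A\<close>
  whose values outside \<open>D\<close> are irrelevant. On \<open>op_power_dom D A k\<close> the power
  \<open>A\<^sup>k\<close> is \<open>A ^^ k\<close>.\<close>

primrec op_power_dom :: "'x set \<Rightarrow> ('x \<Rightarrow> 'x) \<Rightarrow> nat \<Rightarrow> 'x set" where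
  "op_power_dom D A 0 = UNIV"
| "op_power_dom D A (Suc k) = {x \<in> op_power_dom D A k. (A ^^ k) x \<in> D}"

definition poly_op :: "real poly \<Rightarrow> ('x::real_vector \<Rightarrow> 'x) \<Rightarrow> 'x \<Rightarrow> 'x" where
  "poly_op P A x = (\<Sum>k\<le>degree P. (A ^^ k) (coeff P k *\<^sub>R x))"

definition poly_op_inv :: "real poly \<Rightarrow> 'x set \<Rightarrow> ('x::real_vector \<Rightarrow> 'x) \<Rightarrow> 'x \<Rightarrow> 'x" where
  "poly_op_inv P D A = inv_into (op_power_dom D A (degree P)) (poly_op P A)"

text \<open>Only the values \<open>T t\<close> for \<open>t \<ge> 0\<close> matter.\<close>

definition right_linear_semigroup ::
    "('x::real_normed_vector \<Rightarrow> 'a \<Rightarrow> 'x) \<Rightarrow> (real \<Rightarrow> 'x \<Rightarrow> 'x) \<Rightarrow> bool" where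
  "right_linear_semigroup rsm T \<longleftrightarrow>
     (\<forall>t\<ge>0. T t \<in> bounded_right_linear rsm) \<and>
     (\<forall>x. continuous_on {0..} (\<lambda>t. T t x)) \<and>
     (\<forall>t>0. \<forall>s>0. T (t + s) = T t \<circ> T s) \<and>
     T 0 = id"

definition generator_dom :: "(real \<Rightarrow> 'x::real_normed_vector \<Rightarrow> 'x) \<Rightarrow> 'x set" where
  "generator_dom T = {x. \<exists>y. ((\<lambda>h. (1 / h) *\<^sub>R (T h x - x)) \<longlongrightarrow> y) (at_right 0)}"

definition generator :: "(real \<Rightarrow> 'x::real_normed_vector \<Rightarrow> 'x) \<Rightarrow> 'x \<Rightarrow> 'x" where
  "generator T x = Lim (at_right 0) (\<lambda>h. (1 / h) *\<^sub>R (T h x - x))"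

text \<open>The library's \<^const>\<open>has_bochner_integral\<close> is restricted to second countable
  target spaces. For an arbitrary normed target, Borel measurability of \<open>f\<close> has to be
  replaced by strong measurability, i.e. almost everywhere convergence of simple functions.\<close>

definition has_strong_bochner_integral ::
    "'b measure \<Rightarrow> ('b \<Rightarrow> 'x::real_normed_vector) \<Rightarrow> 'x \<Rightarrow> bool" where
  "has_strong_bochner_integral M f I \<longleftrightarrow>
     (\<exists>s. (\<forall>i. Bochner_Integration.simple_bochner_integrable M (s i)) \<and>
          (AE t in M. (\<lambda>i. s i t) \<longlonglongrightarrow> f t) \<and>
          (\<lambda>i. \<integral>\<^sup>+t. ennreal (norm (f t - s i t)) \<partial>M) \<longlonglongrightarrow> 0 \<and>
          (\<lambda>i. Bochner_Integration.simple_bochner_integral M (s i)) \<longlonglongrightarrow> I)"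

definition strong_bochner_integrable ::
    "'b measure \<Rightarrow> ('b \<Rightarrow> 'x::real_normed_vector) \<Rightarrow> bool" where
  "strong_bochner_integrable M f \<longleftrightarrow> (\<exists>I. has_strong_bochner_integral M f I)"

definition strong_bochner_integral ::
    "'b measure \<Rightarrow> ('b \<Rightarrow> 'x::real_normed_vector) \<Rightarrow> 'x" where
  "strong_bochner_integral M f = (THE I. has_strong_bochner_integral M f I)"

definition laplace_space ::
    "(real \<Rightarrow> 'x::real_normed_vector \<Rightarrow> 'x) \<Rightarrow> (real \<Rightarrow> 'a::real_normed_vector) set" where
  "laplace_space T = {g. continuous_on {0..} g \<and>
     integrable (lebesgue_on {0..}) (\<lambda>t. onorm (T t) * norm (g t))}"

definition laplace_op ::
    "('a \<Rightarrow> 'x \<Rightarrow> 'x) \<Rightarrow> (real \<Rightarrow> 'x::real_normed_vector \<Rightarrow> 'x) \<Rightarrow> (real \<Rightarrow> 'a) \<Rightarrow> 'x \<Rightarrow> 'x" where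
  "laplace_op lsm T g x = strong_bochner_integral (lebesgue_on {0..}) (\<lambda>t. T t (lsm (g t) x))"

definition half_line_deriv :: "(real \<Rightarrow> real) \<Rightarrow> real \<Rightarrow> real" where
  "half_line_deriv g t = vector_derivative g (at t within {0..})"

definition smooth_on_half_line :: "(real \<Rightarrow> real) \<Rightarrow> bool" where
  "smooth_on_half_line g \<longleftrightarrow> (\<forall>j. (half_line_deriv ^^ j) g differentiable_on {0..})"

definition solves_gP_problem :: "nat \<Rightarrow> real poly \<Rightarrow> (real \<Rightarrow> real) \<Rightarrow> bool" where
  "solves_gP_problem m P g \<longleftrightarrow>
     smooth_on_half_line g \<and>
     (\<forall>t\<ge>0. (\<Sum>k\<le>m + 2. (- 1) ^ k * coeff P k * (half_line_deriv ^^ k) g t) = 0) \<and>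
     (\<forall>j\<le>m. (half_line_deriv ^^ j) g 0 = 0) \<and>
     (half_line_deriv ^^ (m + 1)) g 0 = (- 1) ^ m * inverse (coeff P (m + 2))"

text \<open>A function on \<open>[0,\<infinity>)\<close> is represented by its extension by zero, so that the
  solution is unique as an element of the type.\<close>

definition gP :: "nat \<Rightarrow> real poly \<Rightarrow> real \<Rightarrow> real" where
  "gP m P = (THE g. solves_gP_problem m P g \<and> (\<forall>t<0. g t = 0))"

abbreviation cpoly :: "real poly \<Rightarrow> complex poly" where
  "cpoly P \<equiv> map_poly complex_of_real P"

definition complex_roots :: "real poly \<Rightarrow> complex set" where
  "complex_roots P = {z. poly (cpoly P) z = 0}"

definition min_re_root :: "real poly \<Rightarrow> real" where
  "min_re_root P = Min (Re ` complex_roots P)"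

text \<open>The Laplace transform of \<open>g\<^sub>P\<close> is \<open>1 / P(-z)\<close>, whose poles are the points
  \<open>-l\<close> with \<open>l\<close> a root of \<open>P\<close>. The number below is the coefficient of
  \<open>(z + l)\<^sup>-\<^sup>k\<close> in its Laurent expansion at \<open>-l\<close>, so that
  \<open>g\<^sub>P(t)\<close> is the sum over the roots \<open>l\<close> and \<open>1 \<le> k \<le> order l (cpoly P)\<close>
  of \<open>laurent_coeff P l k * t\<^sup>k\<^sup>-\<^sup>1 * exp (- l * t) / fact (k - 1)\<close>.\<close>

definition laurent_coeff :: "real poly \<Rightarrow> complex \<Rightarrow> nat \<Rightarrow> complex" where
  "laurent_coeff P l k = residue (\<lambda>z. (z + l) ^ (k - 1) / poly (cpoly P) (- z)) (- l)"

end

theory Submission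
  imports Defs
begin

text \<open>Write \<open>J(\<phi>) x\<close> for the integral of \<open>\<phi>(t) T(t) x\<close> over the half-line. For a scalar weight \<open>\<phi>\<close>
  that decays, together with its derivatives, faster than the semigroup can grow, shifting the
  integration variable gives the integration by parts formula
  \<open>A J(\<phi>) x = - \<phi>(0) x - J(\<phi>') x\<close>, for every \<open>x\<close> in the space (\<open>generates_orbit_integral\<close>).
  Apply it repeatedly to \<open>\<phi> = g\<^sub>P\<close>. The first \<open>m + 1\<close> initial values vanish, so
  \<open>A\<^sup>j J(g\<^sub>P) = (-1)\<^sup>j J(g\<^sub>P\<^sup>(\<^sup>j\<^sup>))\<close> for \<open>j \<le> m + 1\<close>; applied to \<open>p\<^sub>j x\<close> and summed, this is the second integral formula. The last
  initial value contributes exactly \<open>x\<close> to \<open>P(A) J(g\<^sub>P) x\<close>, and the remaining terms are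
  the integral of the differential equation, hence zero. So \<open>P(A) J(g\<^sub>P) = Id\<close>. Since \<open>J(g\<^sub>P)\<close> is bounded
  and commutes with the semigroup, it commutes with \<open>A\<close> on its domain, and \<open>J(g\<^sub>P) P(A) = Id\<close>
  on the domain of \<open>A\<^sup>m\<^sup>+\<^sup>2\<close> (\<open>poly_op_orbit_integral\<close>, \<open>orbit_integral_poly_op\<close>).

  Existence, decay and size of \<open>g\<^sub>P\<close> come from one formula, the inverse Laplace transform of
  \<open>1 / P(-z)\<close>: the \<open>j\<close>-th derivative of \<open>g\<^sub>P\<close> is the sum of the residues of \<open>z\<^sup>j e\<^sup>t\<^sup>z / P(-z)\<close>. Small circles
  around the poles, which lie at the negatives of the roots of \<open>P\<close>, give differentiability in \<open>t\<close> and the decay rate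
  (\<open>residue_kernel_has_vector_derivative\<close>, \<open>residue_kernel_decay\<close>); multiplying by \<open>P(-z)\<close> cancels
  all poles, which is the differential equation; one large circle gives the initial values
  (\<open>residue_kernel_initial\<close>); and the Taylor polynomial of the exponential at each pole gives the
  explicit sum of terms \<open>t\<^sup>k\<^sup>-\<^sup>1 e\<^sup>-\<^sup>l\<^sup>t / (k - 1)!\<close> (\<open>residue_exp_expansion\<close>). Integrating the latter
  against the growth bound of the semigroup yields the norm estimate. Uniqueness for the initial value
  problem (\<open>linear_ode_zero\<close>) identifies this function with \<open>g\<^sub>P\<close>.

  The integrals are handled as gauge integrals, which behave well in every Banach space, separable
  or not, and the Bochner integral defined by
  strong approximation is shown to agree with it for continuous integrands of exponential decay
  (\<open>strong_bochner_integral_half_line\<close>).\<close>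

section \<open>Continuous integrands of exponential decay on a half-line\<close>

text \<open>In every Banach space a gauge integral converges if it converges on bounded intervals and
  the integrand is dominated by an integrable real function. The restriction to a bounded interval is continuous, hence
  integrable.\<close>

lemma integrable_exp_bounded:
  fixes f :: "real \<Rightarrow> 'x::banach"
  assumes cont: "continuous_on {a..} f" and c: "c > 0"
    and bound: "\<And>t. t \<ge> a \<Longrightarrow> norm (f t) \<le> C * exp (- c * t)"
  shows "f integrable_on {a..}"
proof (rule integrable_on_all_intervals_integrable_bound)
  fix u v :: real
  have "f integrable_on cbox (max a u) v"
    by (intro integrable_continuous continuous_on_subset[OF cont]) auto
  moreover have "cbox (max a u) v = {a..} \<inter> cbox u v" by auto
  ultimately show "(\<lambda>t. if t \<in> {a..} then f t else 0) integrable_on cbox u v"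
    using integrable_restrict_Int[of "{a..}" f "cbox u v"] by simp
next
  show "(\<lambda>t. C * exp (- c * t)) integrable_on {a..}"
    using has_integral_mult_right[OF has_integral_exp_minus_to_infinity[OF c]]
    by (blast intro: has_integral_integrable)
qed (use bound in auto)

lemma norm_integral_exp_bounded:
  fixes f :: "real \<Rightarrow> 'x::banach"
  assumes cont: "continuous_on {a..} f" and c: "c > 0"
    and bound: "\<And>t. t \<ge> a \<Longrightarrow> norm (f t) \<le> C * exp (- c * t)"
  shows "norm (integral {a..} f) \<le> C * (exp (- c * a) / c)"
proof -
  have *: "((\<lambda>t. C * exp (- c * t)) has_integral C * (exp (- c * a) / c)) {a..}"
    by (rule has_integral_mult_right[OF has_integral_exp_minus_to_infinity[OF c]])
  have "norm (integral {a..} f) \<le> integral {a..} (\<lambda>t. C * exp (- c * t))"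
    using * by (intro integral_norm_bound_integral integrable_exp_bounded[OF assms] has_integral_integrable[OF *]) (use bound in auto)
  then show ?thesis unfolding integral_unique[OF *] .
qed

lemma integral_half_line_split:
  fixes f :: "real \<Rightarrow> 'x::banach"
  assumes cont: "continuous_on {a..} f" and c: "c > 0"
    and bound: "\<And>t. t \<ge> a \<Longrightarrow> norm (f t) \<le> C * exp (- c * t)"
    and "a \<le> b"
  shows "integral {a..} f = integral {a..b} f + integral {b..} f"
proof -
  have "f integrable_on {a..b}"
    by (intro integrable_continuous_interval continuous_on_subset[OF cont]) auto
  moreover have "f integrable_on {b..}"
    using \<open>a \<le> b\<close> by (intro integrable_exp_bounded[OF continuous_on_subset[OF cont] c bound]) auto
  moreover have "{a..} = {a..b} \<union> {b..}" "{a..b} \<inter> {b..} = {b}"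
    using \<open>a \<le> b\<close> by auto
  ultimately show ?thesis by (metis integral_Un negligible_sing)
qed

lemma tendsto_integral_half_line:
  fixes f :: "real \<Rightarrow> 'x::banach"
  assumes cont: "continuous_on {a..} f" and c: "c > 0"
    and bound: "\<And>t. t \<ge> a \<Longrightarrow> norm (f t) \<le> C * exp (- c * t)"
  shows "((\<lambda>b. integral {a..b} f) \<longlongrightarrow> integral {a..} f) at_top"
proof (rule Lim_transform2[OF _ Lim_null_comparison])
  show "((\<lambda>b. integral {a..} f) \<longlongrightarrow> integral {a..} f) at_top" by simp
  show "\<forall>\<^sub>F b in at_top. norm (integral {a..} f - integral {a..b} f) \<le> C * (exp (- c * b) / c)"
    using eventually_ge_at_top[of a]
  proof eventually_elim
    case (elim b)
    have "integral {a..} f - integral {a..b} f = integral {b..} f"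
      using integral_half_line_split[OF cont c bound elim] by simp
    moreover have "norm (integral {b..} f) \<le> C * (exp (- c * b) / c)"
      using elim by (intro norm_integral_exp_bounded[OF continuous_on_subset[OF cont] c] bound) auto
    ultimately show ?case by simp
  qed
  have "((\<lambda>b. exp (- c * b)) \<longlongrightarrow> 0) at_top"
    using c by (intro filterlim_compose[OF exp_at_bot] filterlim_tendsto_neg_mult_at_bot[OF tendsto_const _ filterlim_ident]) auto
  then show "((\<lambda>b. C * (exp (- c * b) / c)) \<longlongrightarrow> 0) at_top"
    by (intro tendsto_mult_right_zero tendsto_divide_zero)
qed

text \<open>Translation on bounded intervals, then \<open>b \<longlonglongrightarrow> \<infinity>\<close>. This is the identity that
  turns the action of \<open>T(h)\<close> on an integral over the half-line into a shift of the weight.\<close>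

lemma integral_half_line_shift:
  fixes f :: "real \<Rightarrow> 'x::banach"
  assumes cont: "continuous_on {0..} f" and c: "c > 0"
    and bound: "\<And>t. t \<ge> 0 \<Longrightarrow> norm (f t) \<le> C * exp (- c * t)" and h: "h \<ge> 0"
  shows "integral {0..} (\<lambda>t. f (t + h)) = integral {0..} f - integral {0..h} f"
proof -
  have cont': "continuous_on {0..} (\<lambda>t. f (t + h))"
    using h by (intro continuous_on_compose2[OF cont] continuous_intros) auto
  have bound': "norm (f (t + h)) \<le> (C * exp (- c * h)) * exp (- c * t)" if "t \<ge> 0" for t
    using bound[of "t + h"] h that by (simp add: exp_add[symmetric] algebra_simps)
  have "((\<lambda>b. integral {0..b} (\<lambda>t. f (t + h))) \<longlongrightarrow> integral {0..} (\<lambda>t. f (t + h))) at_top"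
    by (rule tendsto_integral_half_line[OF cont' c bound'])
  moreover have "((\<lambda>b. integral {h..b + h} f) \<longlongrightarrow> integral {h..} f) at_top"
    using h by (intro filterlim_compose[OF tendsto_integral_half_line[OF continuous_on_subset[OF cont] c bound]]
        filterlim_at_top_add_at_top filterlim_tendsto_add_at_top[OF tendsto_const filterlim_ident, of h, simplified add.commute]) auto
  moreover have "integral {0..b} (\<lambda>t. f (t + h)) = integral {h..b + h} f" for b
    using integral_shift_real_ivl[of h h "b + h" f] by simp
  ultimately have "integral {0..} (\<lambda>t. f (t + h)) = integral {h..} f"
    using tendsto_unique[OF trivial_limit_at_top_linorder] by (auto simp: trivial_limit_at_top_linorder)
  then show ?thesis
    using integral_half_line_split[OF cont c bound h] by simp
qed

text \<open>A single term of the exponential series of \<open>c t / 2\<close> is at most \<open>exp (c t / 2)\<close>, so half of the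
  decay rate absorbs the power.\<close>

lemma power_exp_bound:
  fixes c t :: real
  assumes "c > 0" "t \<ge> 0"
  shows "t ^ k / fact k * exp (- c * t) \<le> (2 / c) ^ k * exp (- (c / 2) * t)"
proof -
  define x where "x = c / 2 * t"
  have "x \<ge> 0" using assms by (simp add: x_def)
  then have "(\<Sum>n\<in>{k}. x ^ n /\<^sub>R fact n) \<le> exp x"
    unfolding exp_def by (intro sum_le_suminf summable_exp_generic) auto
  then have "(2 / c) ^ k * (x ^ k / fact k) * exp (- c * t) \<le> (2 / c) ^ k * exp x * exp (- c * t)"
    using assms by (intro mult_right_mono mult_left_mono) (simp_all add: field_simps)
  also have "(2 / c) ^ k * (x ^ k / fact k) = t ^ k / fact k"
    using assms by (simp add: x_def power_mult_distrib[symmetric])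
  also have "(2 / c) ^ k * exp x * exp (- c * t) = (2 / c) ^ k * exp (x + - c * t)"
    unfolding exp_add by simp
  also have "x + - c * t = - (c / 2) * t" by (simp add: x_def)
  finally show ?thesis .
qed

text \<open>With \<open>F\<^sub>k(t) = t\<^sup>k / k! \<cdot> exp (- c t)\<close> one has \<open>F\<^sub>k\<^sub>+\<^sub>1' = F\<^sub>k - c F\<^sub>k\<^sub>+\<^sub>1\<close>, and \<open>F\<^sub>k\<^sub>+\<^sub>1\<close> vanishes at both ends of
  the half-line; so each integral is the previous one divided by \<open>c\<close>.\<close>

lemma has_integral_power_exp:
  fixes c :: real
  assumes c: "c > 0"
  shows "((\<lambda>t. t ^ k / fact k * exp (- c * t)) has_integral 1 / c ^ Suc k) {0..}"
proof (induction k)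
  case 0
  then show ?case using has_integral_exp_minus_to_infinity[OF c, of 0] by simp
next
  case (Suc k)
  let ?F = "\<lambda>k t. t ^ k / fact k * exp (- c * t) :: real"
  have cont: "continuous_on S (?F j)" for S j by (intro continuous_intros) auto
  have int: "?F j integrable_on {0..}" for j
    using c power_exp_bound[OF c] by (intro integrable_exp_bounded[of _ _ "c/2" "(2/c)^j"] cont) auto
  have der: "(?F (Suc k) has_vector_derivative ?F k t - c * ?F (Suc k) t) (at t within S)" for t S
  proof -
    have "((\<lambda>t. t ^ Suc k / fact (Suc k)) has_real_derivative t ^ k / fact k) (at t within S)"
      by (rule DERIV_cong[OF DERIV_cdivide[OF DERIV_pow]]) (simp del: of_nat_Suc)
    moreover have "((\<lambda>t. exp (- c * t)) has_real_derivative - c * exp (- c * t)) (at t within S)"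
      by (auto intro!: derivative_eq_intros)
    ultimately have "(?F (Suc k) has_real_derivative t ^ k / fact k * exp (- c * t) + (- c * exp (- c * t)) * (t ^ Suc k / fact (Suc k))) (at t within S)"
      by (rule DERIV_mult)
    then show ?thesis
      unfolding has_real_derivative_iff_has_vector_derivative[symmetric]
      by (rule DERIV_cong) (simp del: fact_Suc power_Suc)
  qed
  have lim: "((\<lambda>b. integral {0..b} (\<lambda>t. ?F k t - c * ?F (Suc k) t)) \<longlongrightarrow> integral {0..} (\<lambda>t. ?F k t - c * ?F (Suc k) t)) at_top"
  proof (rule tendsto_integral_half_line)
    show "continuous_on {0..} (\<lambda>t. ?F k t - c * ?F (Suc k) t)" by (intro continuous_intros) auto
    show "c/2 > 0" using c by simp
    fix t :: real assume t: "t \<ge> 0"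
    have "norm (?F k t - c * ?F (Suc k) t) \<le> ?F k t + c * ?F (Suc k) t"
      using t c by (intro order_trans[OF norm_triangle_ineq4]) auto
    also have "\<dots> \<le> (2/c)^k * exp (- (c / 2) * t) + c * ((2/c)^Suc k * exp (- (c / 2) * t))"
      using c t by (intro add_mono mult_left_mono power_exp_bound) auto
    finally show "norm (?F k t - c * ?F (Suc k) t) \<le> ((2/c)^k + c * (2/c)^Suc k) * exp (- (c / 2) * t)"
      by (simp only: distrib_right mult.assoc)
  qed
  have ftc: "\<forall>\<^sub>F b in at_top. integral {0..b} (\<lambda>t. ?F k t - c * ?F (Suc k) t) = ?F (Suc k) b"
    using eventually_ge_at_top[of 0]
  proof eventually_elim
    case (elim b)
    then show ?case
      using fundamental_theorem_of_calculus[of 0 b "?F (Suc k)" "\<lambda>t. ?F k t - c * ?F (Suc k) t"] der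
      by (simp add: integral_unique)
  qed
  have "(?F (Suc k) \<longlongrightarrow> 0) at_top"
  proof (rule Lim_null_comparison)
    show "\<forall>\<^sub>F t in at_top. norm (?F (Suc k) t) \<le> (2/c)^Suc k * exp (- (c / 2) * t)"
      using eventually_ge_at_top[of 0]
    proof eventually_elim
      case (elim t)
      then have "norm (?F (Suc k) t) = ?F (Suc k) t" by simp
      also have "\<dots> \<le> (2/c)^Suc k * exp (- (c / 2) * t)" by (rule power_exp_bound[OF c elim])
      finally show ?case .
    qed
    have "((\<lambda>b. exp (- (c/2) * b)) \<longlongrightarrow> 0) at_top"
      using c by (intro filterlim_compose[OF exp_at_bot] filterlim_tendsto_neg_mult_at_bot[OF tendsto_const _ filterlim_ident]) auto
    then show "((\<lambda>t. (2/c)^Suc k * exp (- (c / 2) * t)) \<longlongrightarrow> 0) at_top"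
      by (intro tendsto_mult_right_zero)
  qed
  with Lim_transform_eventually[OF lim ftc]
  have "integral {0..} (\<lambda>t. ?F k t - c * ?F (Suc k) t) = 0"
    by (rule tendsto_unique[OF trivial_limit_at_top_linorder])
  moreover have "integral {0..} (\<lambda>t. ?F k t - c * ?F (Suc k) t) = integral {0..} (?F k) - c * integral {0..} (?F (Suc k))"
    unfolding integral_mult_right[symmetric]
    by (intro integral_diff int integrable_on_mult_right)
  moreover have "integral {0..} (?F k) = 1 / c ^ Suc k" using Suc by (rule integral_unique)
  ultimately have "c * integral {0..} (?F (Suc k)) = 1 / c ^ Suc k" by linarith
  moreover have "c * I = 1 / c ^ Suc k \<Longrightarrow> I = 1 / c ^ Suc (Suc k)" for I
    using c by (simp add: field_simps)
  ultimately have "integral {0..} (?F (Suc k)) = 1 / c ^ Suc (Suc k)" by blast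
  then show ?case using integrable_integral[OF int[of "Suc k"]] by (simp only:)
qed

section \<open>The Bochner integral by strong approximation\<close>

text \<open>The bridge between the two integrals: a simple function is a finite
  combination of indicators of sets of finite measure, for which both integrals are the measure.\<close>

lemma simple_bochner_integrable_has_integral:
  fixes s :: "real \<Rightarrow> 'x::banach"
  assumes S: "S \<in> sets lebesgue"
    and s: "Bochner_Integration.simple_bochner_integrable (lebesgue_on S) s"
  shows "(s has_integral Bochner_Integration.simple_bochner_integral (lebesgue_on S) s) S"
proof -
  define E where "E y = {t \<in> S. s t = y}" for y
  have simple: "simple_function (lebesgue_on S) s"
    and fin: "emeasure (lebesgue_on S) {t \<in> S. s t \<noteq> 0} \<noteq> \<infinity>"
    using s by (auto simp: simple_bochner_integrable.simps)
  have meas: "E y \<in> sets (lebesgue_on S)" for y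
    using simple_functionD(2)[OF simple, of "{y}"] by (simp add: E_def vimage_def Int_def conj_commute)
  have S': "{t \<in> S. s t \<noteq> 0} \<in> sets (lebesgue_on S)"
    using simple_functionD(2)[OF simple, of "- {0}"] by (simp add: vimage_def Int_def conj_commute)
  have int: "((\<lambda>t. indicat_real (E y) t *\<^sub>R y) has_integral measure (lebesgue_on S) (E y) *\<^sub>R y) S" for y
  proof (cases "y = 0")
    case False
    then have "emeasure (lebesgue_on S) (E y) \<le> emeasure (lebesgue_on S) {t \<in> S. s t \<noteq> 0}"
      by (intro emeasure_mono S') (auto simp: E_def)
    then have "emeasure (lebesgue_on S) (E y) < \<infinity>"
      using fin by (simp add: top.not_eq_extremum le_less_trans)
    moreover have "E y \<subseteq> S" by (auto simp: E_def)
    moreover have "E y \<in> sets lebesgue"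
      using meas[of y] S by (simp add: sets_restrict_space_iff)
    ultimately have "E y \<in> lmeasurable"
      using S by (auto simp: fmeasurable_def emeasure_restrict_space)
    then have "(indicat_real (E y) has_integral measure lebesgue (E y)) UNIV"
      by (simp add: lmeasurable_iff_has_integral)
    moreover have "indicat_real (E y) = (\<lambda>t. if t \<in> S then indicat_real (E y) t else 0)"
      using \<open>E y \<subseteq> S\<close> by (intro ext) (auto simp: indicator_def)
    ultimately have "(indicat_real (E y) has_integral measure lebesgue (E y)) S"
      by (metis has_integral_restrict_UNIV)
    moreover have "measure lebesgue (E y) = measure (lebesgue_on S) (E y)"
      using S \<open>E y \<subseteq> S\<close> by (simp add: measure_restrict_space)
    ultimately show ?thesis by (metis has_integral_scaleR_left)
  qed simp
  have "((\<lambda>t. \<Sum>y\<in>s ` S. indicat_real (E y) t *\<^sub>R y) has_integral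
      (\<Sum>y\<in>s ` S. measure (lebesgue_on S) (E y) *\<^sub>R y)) S"
    using simple_functionD(1)[OF simple] by (intro has_integral_sum int) auto
  moreover have "(\<Sum>y\<in>s ` S. indicat_real (E y) t *\<^sub>R y) = s t" if "t \<in> S" for t
    using simple_functionD(1)[OF simple] that
    by (subst sum.remove[of _ "s t"]) (auto simp: E_def indicator_def intro!: sum.neutral)
  moreover have "Bochner_Integration.simple_bochner_integral (lebesgue_on S) s
      = (\<Sum>y\<in>s ` S. measure (lebesgue_on S) (E y) *\<^sub>R y)"
    by (simp add: Bochner_Integration.simple_bochner_integral_def E_def)
  ultimately show ?thesis
    by (metis (no_types, lifting) has_integral_eq)
qed

text \<open>Additivity of the nonnegative integral needs measurable summands. In a
  nonseparable space measurability of \<open>f\<close> does not pass to differences such as \<open>f - s\<close> directly,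
  but the distance from \<open>f\<close> to a simple function is pieced together from the finitely many
  functions \<open>norm (f t - y)\<close>.\<close>

lemma borel_measurable_norm_diff_simple:
  fixes f s :: "'b \<Rightarrow> 'x::real_normed_vector"
  assumes f: "\<And>y. (\<lambda>t. norm (f t - y)) \<in> borel_measurable M" and s: "simple_function M s"
  shows "(\<lambda>t. norm (f t - s t)) \<in> borel_measurable M"
proof -
  have "s \<in> M \<rightarrow>\<^sub>M count_space (s ` space M)"
    using s by (auto simp: simple_function_def measurable_count_space_eq2)
  from measurable_compose_countable'[OF f this]
  show ?thesis using simple_functionD(1)[OF s] by (simp add: countable_finite)
qed

text \<open>Two approximating sequences have simple integrals that differ by at most the sum
  of their \<open>L\<^sup>1\<close> distances to \<open>f\<close>.\<close>

lemma has_strong_bochner_integral_unique: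
  fixes f :: "'b \<Rightarrow> 'x::real_normed_vector"
  assumes f: "\<And>y. (\<lambda>t. norm (f t - y)) \<in> borel_measurable M"
    and I: "has_strong_bochner_integral M f I" and J: "has_strong_bochner_integral M f J"
  shows "I = J"
proof -
  from I obtain s where s: "\<And>i. Bochner_Integration.simple_bochner_integrable M (s i)"
    "(\<lambda>i. \<integral>\<^sup>+t. ennreal (norm (f t - s i t)) \<partial>M) \<longlonglongrightarrow> 0"
    "(\<lambda>i. Bochner_Integration.simple_bochner_integral M (s i)) \<longlonglongrightarrow> I"
    by (auto simp: has_strong_bochner_integral_def)
  from J obtain u where u: "\<And>i. Bochner_Integration.simple_bochner_integrable M (u i)"
    "(\<lambda>i. \<integral>\<^sup>+t. ennreal (norm (f t - u i t)) \<partial>M) \<longlonglongrightarrow> 0"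
    "(\<lambda>i. Bochner_Integration.simple_bochner_integral M (u i)) \<longlonglongrightarrow> J"
    by (auto simp: has_strong_bochner_integral_def)
  let ?S = "Bochner_Integration.simple_bochner_integral M"
  have le: "ennreal (norm (?S (s i) - ?S (u i))) \<le>
      (\<integral>\<^sup>+t. ennreal (norm (f t - s i t)) \<partial>M) + (\<integral>\<^sup>+t. ennreal (norm (f t - u i t)) \<partial>M)" for i
  proof -
    have su: "Bochner_Integration.simple_bochner_integrable M (\<lambda>t. s i t - u i t)"
      by (intro simple_bochner_integrable_compose2[where p = "\<lambda>x y. x - y"] s u) auto
    have "norm (?S (s i) - ?S (u i)) = norm (?S (\<lambda>t. s i t - u i t))"
      by (simp add: simple_bochner_integral_diff s u)
    also have "\<dots> \<le> ?S (\<lambda>t. norm (s i t - u i t))"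
      by (rule simple_bochner_integral_norm_bound[OF su])
    finally have "ennreal (norm (?S (s i) - ?S (u i))) \<le> ennreal (?S (\<lambda>t. norm (s i t - u i t)))"
      by (rule ennreal_leI)
    also have "\<dots> = (\<integral>\<^sup>+t. ennreal (norm (s i t - u i t)) \<partial>M)"
      by (intro simple_bochner_integral_eq_nn_integral
          simple_bochner_integrable_compose2[where p = "\<lambda>x y. norm (x - y)"] s u) auto
    also have "\<dots> \<le> (\<integral>\<^sup>+t. ennreal (norm (f t - s i t)) + ennreal (norm (f t - u i t)) \<partial>M)"
    proof (intro nn_integral_mono)
      fix t
      have "norm (s i t - u i t) \<le> norm (f t - s i t) + norm (f t - u i t)"
        by (metis add.commute norm_diff_triangle_ineq norm_minus_commute diff_add_cancel norm_triangle_sub dist_norm dist_triangle3)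
      then show "ennreal (norm (s i t - u i t)) \<le> ennreal (norm (f t - s i t)) + ennreal (norm (f t - u i t))"
        by (simp flip: ennreal_plus)
    qed
    also have "\<dots> = (\<integral>\<^sup>+t. ennreal (norm (f t - s i t)) \<partial>M) + (\<integral>\<^sup>+t. ennreal (norm (f t - u i t)) \<partial>M)"
      using s(1)[of i] u(1)[of i]
      by (intro nn_integral_add measurable_compose[OF borel_measurable_norm_diff_simple[OF f] measurable_ennreal])
         (auto simp: simple_bochner_integrable.simps)
    finally show ?thesis .
  qed
  have "(\<lambda>i. (\<integral>\<^sup>+t. ennreal (norm (f t - s i t)) \<partial>M) + (\<integral>\<^sup>+t. ennreal (norm (f t - u i t)) \<partial>M)) \<longlonglongrightarrow> 0"
    using tendsto_add[OF s(2) u(2)] by simp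
  then have "(\<lambda>i. ennreal (norm (?S (s i) - ?S (u i)))) \<longlonglongrightarrow> 0"
    by (rule tendsto_sandwich[OF _ _ tendsto_const, rotated 2]) (simp_all add: le)
  moreover have "(\<lambda>i. ennreal (norm (?S (s i) - ?S (u i)))) \<longlonglongrightarrow> ennreal (norm (I - J))"
    by (intro tendsto_ennrealI tendsto_norm tendsto_diff s u)
  ultimately have "ennreal (norm (I - J)) = 0"
    by (rule LIMSEQ_unique[rotated])
  then show ?thesis by simp
qed

text \<open>On a compact interval uniform continuity allows \<open>f\<close> to be sampled on a grid of mesh \<open>d / 2\<close>.
  The index \<open>-1\<close> marks the part beyond \<open>b\<close>, where the step function is zero; it keeps the index
  function integer valued with finite range, so that simplicity follows from that of the index.\<close>

lemma step_function_approx: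
  fixes f :: "real \<Rightarrow> 'x::banach"
  assumes cont: "continuous_on {0..} f" and e: "e > 0" and b: "b \<ge> 0"
  obtains s where "Bochner_Integration.simple_bochner_integrable (lebesgue_on {0..}) s"
    "\<And>t. 0 \<le> t \<Longrightarrow> t \<le> b \<Longrightarrow> norm (f t - s t) \<le> e" "\<And>t. t > b \<Longrightarrow> s t = 0"
proof -
  have "uniformly_continuous_on {0..b} f"
    using cont by (intro compact_uniformly_continuous) (auto intro: continuous_on_subset)
  then obtain d where d: "d > 0" "\<And>t u. t \<in> {0..b} \<Longrightarrow> u \<in> {0..b} \<Longrightarrow> dist u t < d \<Longrightarrow> dist (f u) (f t) < e"
    using e unfolding uniformly_continuous_on_def by metis
  define k where "k t = (if t \<le> b then \<lfloor>2 * t / d\<rfloor> else -1)" for t :: real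
  define v where "v n = (if n < 0 then 0 else f (real_of_int n * (d / 2)))" for n :: int
  let ?M = "lebesgue_on {0::real..}"
  have "k ` space ?M \<subseteq> {-1..\<lfloor>2 * b / d\<rfloor>}"
    using d(1) b by (auto simp: k_def intro!: floor_mono divide_right_mono order_trans[of "-1" 0 "\<lfloor>_\<rfloor>"])
  then have "finite (k ` space ?M)" by (rule finite_subset) simp
  moreover have "k \<in> ?M \<rightarrow>\<^sub>M count_space UNIV"
  proof -
    have "k \<in> borel \<rightarrow>\<^sub>M count_space UNIV" unfolding k_def by measurable
    then show ?thesis
      by (intro measurable_restrict_space1 measurable_completion) auto
  qed
  ultimately have "simple_function ?M k"
    using measurable_sets[of k ?M "count_space UNIV"]
    unfolding simple_function_def by (intro conjI ballI) simp_all
  then have simple: "simple_function ?M (\<lambda>t. v (k t))"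
    by (rule simple_function_compose1)
  show ?thesis
  proof
    have "emeasure ?M {t \<in> space ?M. v (k t) \<noteq> 0} \<le> emeasure ?M {0..b}"
      by (intro emeasure_mono) (auto simp: v_def k_def sets_restrict_space_iff split: if_splits)
    also have "\<dots> < \<infinity>" using b by (simp add: emeasure_restrict_space)
    finally show "Bochner_Integration.simple_bochner_integrable ?M (\<lambda>t. v (k t))"
      using simple by (auto simp: simple_bochner_integrable.simps)
    show "v (k t) = 0" if "t > b" for t using that by (simp add: v_def k_def)
    fix t assume t: "0 \<le> t" "t \<le> b"
    define n where "n = \<lfloor>2 * t / d\<rfloor>"
    have n: "n \<ge> 0" "real_of_int n \<le> 2 * t / d" "2 * t / d < real_of_int n + 1"
      using t d(1) by (auto simp: n_def)
    then have "real_of_int n * (d / 2) \<le> t" "t < real_of_int n * (d / 2) + d / 2"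
      using d(1) by (auto simp: field_simps)
    then have "dist (f t) (f (real_of_int n * (d / 2))) < e"
      using n(1) d(1) t by (intro d(2)) (auto simp: dist_real_def)
    then show "norm (f t - v (k t)) \<le> e"
      using t n(1) by (simp add: k_def v_def n_def[symmetric] dist_norm)
  qed
qed

text \<open>Approximate \<open>f\<close> within \<open>1 / (i + 1)\<^sup>2\<close> on \<open>[0, i]\<close> and by zero beyond. The
  error is dominated by an explicit function \<open>w i\<close> whose integral \<open>W i\<close> tends to zero: the square
  beats the length \<open>i\<close> of the interval, and the tail of \<open>f\<close> decays. The same
  domination controls both the \<open>L\<^sup>1\<close> error and the distance between the simple integrals and the gauge integral.\<close>

lemma has_strong_bochner_integral_half_line:
  fixes f :: "real \<Rightarrow> 'x::banach"
  assumes cont: "continuous_on {0..} f" and c: "c > 0"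
    and bound: "\<And>t. t \<ge> 0 \<Longrightarrow> norm (f t) \<le> C * exp (- c * t)"
  shows "has_strong_bochner_integral (lebesgue_on {0..}) f (integral {0..} f)"
proof -
  let ?M = "lebesgue_on {0::real..}"
  define e where "e i = 1 / real (Suc i) * (1 / real (Suc i))" for i
  have e: "e i > 0" for i by (simp add: e_def)
  have "\<exists>s. Bochner_Integration.simple_bochner_integrable ?M s \<and>
      (\<forall>t. 0 \<le> t \<longrightarrow> t \<le> real i \<longrightarrow> norm (f t - s t) \<le> e i) \<and> (\<forall>t. t > real i \<longrightarrow> s t = 0)" for i
    by (rule step_function_approx[OF cont e[of i] of_nat_0_le_iff[of i]]) blast
  then obtain s where s: "\<And>i. Bochner_Integration.simple_bochner_integrable ?M (s i)"
    and s1: "\<And>i t. 0 \<le> t \<Longrightarrow> t \<le> real i \<Longrightarrow> norm (f t - s i t) \<le> e i"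
    and s2: "\<And>i t. t > real i \<Longrightarrow> s i t = 0"
    by metis
  define w where "w i t = (if t \<le> real i then e i else C * exp (- c * t))" for i t
  define W where "W i = real i * e i + C * (exp (- c * real i) / c)" for i
  have w: "norm (f t - s i t) \<le> w i t" if "t \<ge> 0" for i t
    using s1[of t i] s2[of i t] bound[of t] that by (auto simp: w_def)
  have wint: "(w i has_integral W i) {0..}" for i
  proof -
    have "((\<lambda>t. e i) has_integral real i * e i) {0..real i}"
      using has_integral_const_real[of "e i" 0 "real i"] by simp
    then have "(w i has_integral real i * e i) {0..real i}"
      by (rule has_integral_eq[rotated]) (simp add: w_def)
    moreover have "((\<lambda>t. C * exp (- c * t)) has_integral C * (exp (- c * real i) / c)) {real i..}"
      by (rule has_integral_mult_right[OF has_integral_exp_minus_to_infinity[OF c]])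
    then have "(w i has_integral C * (exp (- c * real i) / c)) {real i..}"
      by (rule has_integral_spike[of "{real i}", rotated 2]) (auto simp: w_def)
    moreover have "{0..real i} \<union> {real i..} = {0..}" "{0..real i} \<inter> {real i..} = {real i}" by auto
    ultimately show ?thesis
      using has_integral_Un[of "w i" _ "{0..real i}" _ "{real i..}"] by (simp add: W_def)
  qed
  have W: "W \<longlonglongrightarrow> 0"
  proof -
    have "(\<lambda>i. real i / real (Suc i) * (1 / real (Suc i))) \<longlonglongrightarrow> 1 * 0"
      using LIMSEQ_inverse_real_of_nat
      by (intro tendsto_mult LIMSEQ_n_over_Suc_n) (simp add: inverse_eq_divide)
    moreover have "(\<lambda>i. exp (- c * real i)) \<longlonglongrightarrow> 0"
      using c by (intro filterlim_compose[OF exp_at_bot]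
          filterlim_tendsto_neg_mult_at_bot[OF tendsto_const _ filterlim_real_sequentially]) auto
    then have "(\<lambda>i. C * (exp (- c * real i) / c)) \<longlonglongrightarrow> 0"
      by (intro tendsto_mult_right_zero tendsto_divide_zero)
    ultimately have "(\<lambda>i. real i / real (Suc i) * (1 / real (Suc i)) + C * (exp (- c * real i) / c)) \<longlonglongrightarrow> 1 * 0 + 0"
      by (rule tendsto_add)
    then show ?thesis by (simp add: W_def[abs_def] e_def)
  qed
  show ?thesis
    unfolding has_strong_bochner_integral_def
  proof (intro exI[of _ s] conjI allI s)
    show "AE t in ?M. (\<lambda>i. s i t) \<longlonglongrightarrow> f t"
    proof (rule AE_I2)
      fix t assume "t \<in> space ?M"
      then have t: "t \<ge> 0" by simp
      have "\<forall>\<^sub>F i in sequentially. norm (s i t - f t) \<le> e i"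
        using eventually_ge_at_top[of "nat \<lceil>t\<rceil>"]
        by eventually_elim (use s1 t in \<open>auto simp: norm_minus_commute\<close>)
      moreover have "e \<longlonglongrightarrow> 0"
        unfolding e_def using tendsto_mult[OF LIMSEQ_inverse_real_of_nat LIMSEQ_inverse_real_of_nat]
        by (simp add: inverse_eq_divide)
      ultimately have "(\<lambda>i. s i t - f t) \<longlonglongrightarrow> 0"
        by (rule Lim_null_comparison)
      then show "(\<lambda>i. s i t) \<longlonglongrightarrow> f t" by (simp add: LIM_zero_iff)
    qed
    have C: "C \<ge> 0"
      using order_trans[OF norm_ge_zero bound[of 0]] by simp
    have "(\<integral>\<^sup>+t. ennreal (norm (f t - s i t)) \<partial>?M) \<le> ennreal (W i)" for i
    proof -
      have "(\<integral>\<^sup>+t. ennreal (norm (f t - s i t)) \<partial>?M) \<le> (\<integral>\<^sup>+t. ennreal (w i t) \<partial>?M)"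
        by (intro nn_integral_mono ennreal_leI w) auto
      also have "\<dots> = (\<integral>\<^sup>+t. ennreal (w i t) * indicator {0..} t \<partial>lborel)"
        by (simp add: nn_integral_restrict_space nn_integral_completion)
      also have "\<dots> = ennreal (W i)"
        using e C by (intro nn_integral_has_integral_lebesgue' wint) (auto simp: w_def less_imp_le)
      finally show ?thesis .
    qed
    moreover have "(\<lambda>i. ennreal (W i)) \<longlonglongrightarrow> 0"
      using tendsto_ennrealI[OF W] by simp
    ultimately show "(\<lambda>i. \<integral>\<^sup>+t. ennreal (norm (f t - s i t)) \<partial>?M) \<longlonglongrightarrow> 0"
      by (intro tendsto_sandwich[OF _ _ tendsto_const \<open>(\<lambda>i. ennreal (W i)) \<longlonglongrightarrow> 0\<close>]) simp_all
    have "norm (Bochner_Integration.simple_bochner_integral ?M (s i) - integral {0..} f) \<le> W i" for i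
    proof -
      have si: "(s i has_integral Bochner_Integration.simple_bochner_integral ?M (s i)) {0..}"
        by (intro simple_bochner_integrable_has_integral s) simp
      have fi: "f integrable_on {0..}" by (rule integrable_exp_bounded[OF cont c bound])
      have "norm (integral {0..} (\<lambda>t. f t - s i t)) \<le> integral {0..} (w i)"
        by (intro integral_norm_bound_integral integrable_diff fi has_integral_integrable[OF si]
            has_integral_integrable[OF wint] w) auto
      also have "integral {0..} (\<lambda>t. f t - s i t) = integral {0..} f - Bochner_Integration.simple_bochner_integral ?M (s i)"
        by (simp add: integral_diff[OF fi has_integral_integrable[OF si]] integral_unique[OF si])
      also have "integral {0..} (w i) = W i" by (rule integral_unique[OF wint])
      finally show ?thesis by (simp add: norm_minus_commute)
    qed
    then have "(\<lambda>i. Bochner_Integration.simple_bochner_integral ?M (s i) - integral {0..} f) \<longlonglongrightarrow> 0"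
      by (intro Lim_null_comparison[OF _ W] always_eventually allI)
    then show "(\<lambda>i. Bochner_Integration.simple_bochner_integral ?M (s i)) \<longlonglongrightarrow> integral {0..} f"
      by (simp add: LIM_zero_iff)
  qed
qed

lemma strong_bochner_integral_half_line:
  fixes f :: "real \<Rightarrow> 'x::banach"
  assumes cont: "continuous_on {0..} f" and c: "c > 0"
    and bound: "\<And>t. t \<ge> 0 \<Longrightarrow> norm (f t) \<le> C * exp (- c * t)"
  shows "strong_bochner_integrable (lebesgue_on {0..}) f"
    and "strong_bochner_integral (lebesgue_on {0..}) f = integral {0..} f"
proof -
  have "(\<lambda>t. norm (f t - y)) \<in> borel_measurable (lebesgue_on {0..})" for y
    by (intro continuous_imp_measurable_on_sets_lebesgue continuous_intros cont) auto
  note unique = has_strong_bochner_integral_unique[OF this]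
  note has = has_strong_bochner_integral_half_line[OF cont c bound]
  show "strong_bochner_integrable (lebesgue_on {0..}) f"
    unfolding strong_bochner_integrable_def using has by blast
  show "strong_bochner_integral (lebesgue_on {0..}) f = integral {0..} f"
    unfolding strong_bochner_integral_def by (intro the_equality has unique)
qed

section \<open>Semigroups, their generators and weighted orbit integrals\<close>

text \<open>The rate \<open>c\<close> may be negative, because a semigroup with negative growth bound
  tolerates growing weights.\<close>

definition exp_decay :: "real \<Rightarrow> (real \<Rightarrow> real) \<Rightarrow> bool" where
  "exp_decay c \<phi> \<longleftrightarrow> continuous_on {0..} \<phi> \<and> (\<exists>C. \<forall>t\<ge>0. \<bar>\<phi> t\<bar> \<le> C * exp (- c * t))"

locale exp_bounded_semigroup =
  fixes T :: "real \<Rightarrow> 'x::banach \<Rightarrow> 'x" and M \<omega> :: real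
  assumes bounded_linear_T: "t \<ge> 0 \<Longrightarrow> bounded_linear (T t)"
    and continuous_T: "continuous_on {0..} (\<lambda>t. T t x)"
    and T_add: "t \<ge> 0 \<Longrightarrow> s \<ge> 0 \<Longrightarrow> T (t + s) x = T t (T s x)"
    and T_0: "T 0 x = x"
    and norm_T: "t \<ge> 0 \<Longrightarrow> norm (T t x) \<le> M * exp (\<omega> * t) * norm x"
begin

text \<open>For scalar weights this is the operator \<open>L(\<phi>)\<close> of the functional calculus, written with the
  gauge integral.\<close>

definition orbit_integral :: "(real \<Rightarrow> real) \<Rightarrow> 'x \<Rightarrow> 'x" where
  "orbit_integral \<phi> x = integral {0..} (\<lambda>t. \<phi> t *\<^sub>R T t x)"

lemma continuous_weighted_orbit:
  assumes "exp_decay c \<phi>"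
  shows "continuous_on {0..} (\<lambda>t. \<phi> t *\<^sub>R T t x)"
  using assms by (auto simp: exp_decay_def intro!: continuous_intros continuous_T)

lemma norm_weighted_orbit:
  assumes "\<And>t. t \<ge> 0 \<Longrightarrow> \<bar>\<phi> t\<bar> \<le> C * exp (- c * t)" "t \<ge> 0"
  shows "norm (\<phi> t *\<^sub>R T t x) \<le> (C * M * norm x) * exp (- (c - \<omega>) * t)"
proof -
  have "norm (\<phi> t *\<^sub>R T t x) \<le> (C * exp (- c * t)) * (M * exp (\<omega> * t) * norm x)"
    unfolding norm_scaleR using assms order_trans[OF abs_ge_zero assms(1)[of t]]
    by (intro mult_mono norm_T) auto
  also have "\<dots> = (C * M * norm x) * (exp (- c * t) * exp (\<omega> * t))" by simp
  also have "exp (- c * t) * exp (\<omega> * t) = exp (- (c - \<omega>) * t)"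
    unfolding exp_add[symmetric] by (simp add: algebra_simps)
  finally show ?thesis .
qed

lemma exp_bounded_weighted_orbit:
  assumes "exp_decay c \<phi>"
  obtains C where "\<And>t. t \<ge> 0 \<Longrightarrow> norm (\<phi> t *\<^sub>R T t x) \<le> C * exp (- (c - \<omega>) * t)"
  using assms norm_weighted_orbit[of \<phi> _ c _ x] unfolding exp_decay_def by blast

lemma integrable_weighted_orbit:
  assumes "exp_decay c \<phi>" "c > \<omega>"
  shows "(\<lambda>t. \<phi> t *\<^sub>R T t x) integrable_on {0..}"
proof -
  obtain C where "\<And>t. t \<ge> 0 \<Longrightarrow> norm (\<phi> t *\<^sub>R T t x) \<le> C * exp (- (c - \<omega>) * t)"
    using exp_bounded_weighted_orbit[OF assms(1)] by metis
  then show ?thesis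
    using assms by (intro integrable_exp_bounded[OF continuous_weighted_orbit[OF assms(1)], of "c - \<omega>"]) auto
qed

lemma bounded_linear_orbit_integral:
  assumes "exp_decay c \<phi>" "c > \<omega>"
  shows "bounded_linear (orbit_integral \<phi>)"
proof -
  obtain C where C: "\<And>t. t \<ge> 0 \<Longrightarrow> \<bar>\<phi> t\<bar> \<le> C * exp (- c * t)"
    using assms(1) by (auto simp: exp_decay_def)
  note int = integrable_weighted_orbit[OF assms]
  note [simp] = bounded_linear.linear[OF bounded_linear_T, THEN linear_add]
    bounded_linear.linear[OF bounded_linear_T, THEN linear_scale]
  show ?thesis
  proof (rule bounded_linear_intro)
    show "orbit_integral \<phi> (x + y) = orbit_integral \<phi> x + orbit_integral \<phi> y" for x y
      unfolding orbit_integral_def integral_add[OF int int, symmetric]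
      by (intro integral_cong) (simp add: scaleR_add_right)
    show "orbit_integral \<phi> (r *\<^sub>R x) = r *\<^sub>R orbit_integral \<phi> x" for r x
      unfolding orbit_integral_def integral_cmul[symmetric] by (intro integral_cong) simp
    show "norm (orbit_integral \<phi> x) \<le> norm x * (C * M / (c - \<omega>))" for x
    proof -
      have "norm (orbit_integral \<phi> x) \<le> (C * M * norm x) * (exp (- (c - \<omega>) * 0) / (c - \<omega>))"
        unfolding orbit_integral_def using assms(2)
        by (intro norm_integral_exp_bounded continuous_weighted_orbit[OF assms(1)] norm_weighted_orbit C) auto
      then show ?thesis by (simp add: mult_ac)
    qed
  qed
qed

text \<open>Used for two kinds of \<open>B\<close>: the operators \<open>T(h)\<close> and right multiplication by a scalar
  of the algebra.\<close>

lemma commute_orbit_integral: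
  assumes "exp_decay c \<phi>" "c > \<omega>" and B: "bounded_linear B"
    and comm: "\<And>t. t \<ge> 0 \<Longrightarrow> B (T t x) = T t (B x)"
  shows "B (orbit_integral \<phi> x) = orbit_integral \<phi> (B x)"
proof -
  have "B (orbit_integral \<phi> x) = integral {0..} (B \<circ> (\<lambda>t. \<phi> t *\<^sub>R T t x))"
    unfolding orbit_integral_def by (rule integral_linear[OF integrable_weighted_orbit[OF assms(1,2)] B, symmetric])
  also have "\<dots> = orbit_integral \<phi> (B x)"
    unfolding orbit_integral_def by (intro integral_cong) (simp add: linear_scale[OF bounded_linear.linear[OF B]] comm)
  finally show ?thesis .
qed

text \<open>The graph of the generator as a relation, so that membership in the domain and
  the value are obtained from one limit.\<close>

definition generates :: "'x \<Rightarrow> 'x \<Rightarrow> bool" where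
  "generates x y \<longleftrightarrow> ((\<lambda>h. (1 / h) *\<^sub>R (T h x - x)) \<longlongrightarrow> y) (at_right 0)"

lemma generates_generator:
  assumes "generates x y" shows "x \<in> generator_dom T" "generator T x = y"
  using assms tendsto_Lim[OF trivial_limit_at_right_real]
  unfolding generates_def generator_dom_def generator_def by auto

lemma generator_domD: "x \<in> generator_dom T \<Longrightarrow> generates x (generator T x)"
  unfolding generator_dom_def mem_Collect_eq
  using generates_generator(2) by (metis generates_def)

lemma eventually_at_right_0: "\<forall>\<^sub>F h in at_right (0::real). 0 < h \<and> h < 1"
  by (intro eventually_conj eventually_at_right_less eventually_at_rightI[of 0 1]) auto

lemma generates_add:
  assumes "generates x y" "generates x' y'"
  shows "generates (x + x') (y + y')"
proof -
  have "((\<lambda>h. (1 / h) *\<^sub>R (T h x - x) + (1 / h) *\<^sub>R (T h x' - x')) \<longlongrightarrow> y + y') (at_right 0)"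
    using assms by (intro tendsto_add) (auto simp: generates_def)
  then show ?thesis
    unfolding generates_def
    by (rule Lim_transform_eventually, intro eventually_mono[OF eventually_at_right_0])
       (simp add: linear_add[OF bounded_linear.linear[OF bounded_linear_T]] algebra_simps)
qed

lemma generates_scaleR:
  assumes "generates x y"
  shows "generates (r *\<^sub>R x) (r *\<^sub>R y)"
proof -
  have "((\<lambda>h. r *\<^sub>R ((1 / h) *\<^sub>R (T h x - x))) \<longlongrightarrow> r *\<^sub>R y) (at_right 0)"
    using assms by (intro tendsto_scaleR tendsto_const) (auto simp: generates_def)
  then show ?thesis
    unfolding generates_def
    by (rule Lim_transform_eventually, intro eventually_mono[OF eventually_at_right_0])
       (simp add: linear_scale[OF bounded_linear.linear[OF bounded_linear_T]] algebra_simps)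
qed

text \<open>The difference quotient passes through the bounded operator \<open>J(\<phi>)\<close>, which commutes with
  \<open>T(h)\<close>.\<close>

lemma generates_orbit_integral_commute:
  assumes "exp_decay c \<phi>" "c > \<omega>" "generates x y"
  shows "generates (orbit_integral \<phi> x) (orbit_integral \<phi> y)"
proof -
  note J = bounded_linear_orbit_integral[OF assms(1,2)]
  have "((\<lambda>h. orbit_integral \<phi> ((1 / h) *\<^sub>R (T h x - x))) \<longlongrightarrow> orbit_integral \<phi> y) (at_right 0)"
    using assms(3) unfolding generates_def by (rule bounded_linear.tendsto[OF J])
  moreover have "\<forall>\<^sub>F h in at_right 0. orbit_integral \<phi> ((1 / h) *\<^sub>R (T h x - x)) = (1 / h) *\<^sub>R (T h (orbit_integral \<phi> x) - orbit_integral \<phi> x)"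
    using eventually_at_right_0
  proof eventually_elim
    case (elim h)
    then have "T h (orbit_integral \<phi> x) = orbit_integral \<phi> (T h x)"
      by (intro commute_orbit_integral[OF assms(1,2)] bounded_linear_T)
         (simp_all add: T_add[symmetric] add.commute)
    then show ?case
      by (simp add: linear_scale[OF bounded_linear.linear[OF J]] linear_diff[OF bounded_linear.linear[OF J]])
  qed
  ultimately show ?thesis unfolding generates_def by (rule Lim_transform_eventually)
qed

text \<open>Taylor's formula by two applications of the mean value theorem. The
  second one evaluates \<open>\<phi>''\<close> at an intermediate point \<open>\<eta>\<close> at distance less than \<open>1\<close> from \<open>t\<close>;
  replacing \<open>\<eta>\<close> by \<open>t\<close> in the bound costs at most the factor \<open>exp \<bar>c\<bar>\<close>, whatever the sign of \<open>c\<close>.\<close>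

lemma exp_decay_increment:
  fixes \<phi> \<phi>' \<phi>'' :: "real \<Rightarrow> real"
  assumes d1: "\<And>t. t \<ge> 0 \<Longrightarrow> (\<phi> has_vector_derivative \<phi>' t) (at t within {0..})"
    and d2: "\<And>t. t \<ge> 0 \<Longrightarrow> (\<phi>' has_vector_derivative \<phi>'' t) (at t within {0..})"
    and b: "\<And>t. t \<ge> 0 \<Longrightarrow> \<bar>\<phi>'' t\<bar> \<le> C * exp (- c * t)"
    and t: "t \<ge> 0" and h: "0 < h" "h < 1"
  shows "\<bar>\<phi> (t + h) - \<phi> t - h * \<phi>' t\<bar> \<le> h\<^sup>2 * (C * exp \<bar>c\<bar>) * exp (- c * t)"
proof -
  have der: "(f has_derivative (\<lambda>v. v * f' s)) (at s within {u..v})"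
    if "\<And>t. t \<ge> 0 \<Longrightarrow> (f has_vector_derivative f' t) (at t within {0..})" "u \<ge> 0" "s \<in> {u..v}" for f f' s u v
    using has_vector_derivative_within_subset[OF that(1)[of s], of "{u..v}"] that(2,3)
    by (auto simp: has_vector_derivative_def)
  obtain \<xi> where xi: "\<xi> \<in> {t<..<t + h}" "\<phi> (t + h) - \<phi> t = (t + h - t) * \<phi>' \<xi>"
    using mvt_simple[of t "t + h" \<phi> "\<lambda>s v. v * \<phi>' s"] der[OF d1 t] h by auto
  obtain \<eta> where eta: "\<eta> \<in> {t<..<\<xi>}" "\<phi>' \<xi> - \<phi>' t = (\<xi> - t) * \<phi>'' \<eta>"
    using mvt_simple[of t \<xi> \<phi>' "\<lambda>s v. v * \<phi>'' s"] der[OF d2 t] xi(1) by auto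
  have C: "C \<ge> 0" using order_trans[OF abs_ge_zero b[of 0]] by simp
  have "\<phi> (t + h) - \<phi> t - h * \<phi>' t = h * (\<phi>' \<xi> - \<phi>' t)"
    using xi(2) by (simp add: algebra_simps)
  then have "\<bar>\<phi> (t + h) - \<phi> t - h * \<phi>' t\<bar> = h * ((\<xi> - t) * \<bar>\<phi>'' \<eta>\<bar>)"
    using h xi(1) eta(2) by (simp add: abs_mult)
  also have "\<dots> \<le> h * (h * (C * exp (- c * \<eta>)))"
    using h xi(1) eta(1) t C by (intro mult_left_mono mult_mono b) auto
  also have "\<dots> \<le> h * (h * (C * (exp \<bar>c\<bar> * exp (- c * t))))"
  proof -
    have "- c * \<eta> \<le> \<bar>c\<bar> + - c * t"
    proof -
      have "- c * \<eta> - - c * t = - c * (\<eta> - t)" by (simp add: algebra_simps)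
      also have "\<dots> \<le> \<bar>c\<bar> * (\<eta> - t)" using eta(1) by (intro mult_right_mono) auto
      also have "\<dots> \<le> \<bar>c\<bar> * 1" using eta(1) xi(1) h by (intro mult_left_mono) auto
      finally show ?thesis by simp
    qed
    then have "exp (- c * \<eta>) \<le> exp \<bar>c\<bar> * exp (- c * t)" unfolding exp_add[symmetric] by simp
    then show ?thesis using h C by (intro mult_left_mono) auto
  qed
  finally show ?thesis by (simp add: power2_eq_square mult.assoc)
qed

lemma tendsto_initial_average:
  fixes f :: "real \<Rightarrow> 'x"
  assumes "continuous_on {0..} f"
  shows "((\<lambda>h. (1 / h) *\<^sub>R integral {0..h} f) \<longlongrightarrow> f 0) (at_right 0)"
proof -
  have "((\<lambda>u. integral {0..u} f) has_vector_derivative f 0) (at 0 within {0..1})"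
    by (intro integral_has_vector_derivative continuous_on_subset[OF assms]) auto
  then have "((\<lambda>h. (1 / norm (h - 0)) *\<^sub>R (integral {0..h} f - (integral {0..0} f + (h - 0) *\<^sub>R f 0))) \<longlongrightarrow> 0) (at_right 0)"
    unfolding has_vector_derivative_def has_derivative_within
    by (simp add: at_within_Icc_at_right)
  then have "((\<lambda>h. (1 / h) *\<^sub>R integral {0..h} f - f 0) \<longlongrightarrow> 0) (at_right 0)"
    by (rule Lim_transform_eventually, intro eventually_mono[OF eventually_at_right_0])
       (simp add: scaleR_diff_right)
  then show ?thesis by (simp add: LIM_zero_iff)
qed

lemma tendsto_T_0: "((\<lambda>t. T t x) \<longlongrightarrow> x) (at_right 0)"
proof -
  have "((\<lambda>t. T t x) \<longlongrightarrow> T 0 x) (at 0 within {0..})"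
    using continuous_T[of x] by (auto simp: continuous_on_def)
  then show ?thesis unfolding T_0 by (rule tendsto_within_subset) auto
qed

text \<open>Integration by parts for \<open>J(\<phi>)\<close>. Since \<open>T(h) J(\<phi>) x\<close> is the integral of \<open>\<phi>(t) T(t + h) x\<close>, write
  \<open>\<phi>(t) = \<phi>(t + h) - h \<phi>'(t) - (remainder)\<close>. The first term integrates to \<open>J(\<phi>) x\<close> minus the integral
  over \<open>[0, h]\<close>, the second to \<open>h T(h) J(\<phi>') x\<close>, and the remainder is \<open>O(h\<^sup>2)\<close> because \<open>\<phi>''\<close>
  decays. Dividing by \<open>h\<close> gives the limit.\<close>

lemma generates_orbit_integral:
  assumes dec: "exp_decay c \<phi>" "exp_decay c \<phi>'" "exp_decay c \<phi>''" and c: "c > \<omega>"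
    and d1: "\<And>t. t \<ge> 0 \<Longrightarrow> (\<phi> has_vector_derivative \<phi>' t) (at t within {0..})"
    and d2: "\<And>t. t \<ge> 0 \<Longrightarrow> (\<phi>' has_vector_derivative \<phi>'' t) (at t within {0..})"
  shows "generates (orbit_integral \<phi> x) (- (\<phi> 0 *\<^sub>R x) - orbit_integral \<phi>' x)"
proof -
  define \<psi> where "\<psi> t = \<phi> t *\<^sub>R T t x" for t
  \<comment> \<open>\<open>E h\<close> is the integral of the second order Taylor remainder of \<open>\<phi>\<close> against \<open>T(t + h) x\<close>.\<close>
  define E where "E h = orbit_integral \<phi> x - integral {0..h} \<psi> - T h (orbit_integral \<phi> x) - h *\<^sub>R T h (orbit_integral \<phi>' x)" for h
  obtain C where C: "\<And>t. t \<ge> 0 \<Longrightarrow> \<bar>\<phi>'' t\<bar> \<le> C * exp (- c * t)"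
    using dec(3) by (auto simp: exp_decay_def)
  obtain B where B: "\<And>t. t \<ge> 0 \<Longrightarrow> norm (\<psi> t) \<le> B * exp (- (c - \<omega>) * t)"
    using exp_bounded_weighted_orbit[OF dec(1)] unfolding \<psi>_def by metis
  have cont: "continuous_on {0..} \<psi>"
    unfolding \<psi>_def by (rule continuous_weighted_orbit[OF dec(1)])
  define K where "K h = C * exp \<bar>c\<bar> * M * norm (T h x) / (c - \<omega>)" for h
  have E_bound: "norm (E h) \<le> h\<^sup>2 * K h" if h: "0 < h" "h < 1" for h
  proof -
    have Th: "T h (orbit_integral \<phi> x) = integral {0..} (\<lambda>t. \<phi> t *\<^sub>R T t (T h x))" if "exp_decay c \<phi>" for \<phi>
      using commute_orbit_integral[OF that c bounded_linear_T[of h], of x] h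
      by (simp add: orbit_integral_def T_add[symmetric] add.commute)
    have shift: "integral {0..} (\<lambda>t. \<psi> (t + h)) = orbit_integral \<phi> x - integral {0..h} \<psi>"
      using integral_half_line_shift[OF cont _ B, of h] c h by (simp add: orbit_integral_def \<psi>_def[abs_def])
    have int: "(\<lambda>t. \<psi> (t + h)) integrable_on {0..}"
    proof (rule integrable_exp_bounded)
      show "continuous_on {0..} (\<lambda>t. \<psi> (t + h))"
        using h by (intro continuous_on_compose2[OF cont] continuous_intros) auto
      show "c - \<omega> > 0" using c by simp
      show "norm (\<psi> (t + h)) \<le> (B * exp (- (c - \<omega>) * h)) * exp (- (c - \<omega>) * t)" if "t \<ge> 0" for t
        using B[of "t + h"] that h by (simp add: exp_add[symmetric] algebra_simps)
    qed
    note int' = integrable_weighted_orbit[OF dec(1) c, of "T h x"]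
      integrable_cmul[OF integrable_weighted_orbit[OF dec(2) c, of "T h x"], of h]
    have "E h = integral {0..} (\<lambda>t. \<psi> (t + h) - \<phi> t *\<^sub>R T t (T h x) - h *\<^sub>R (\<phi>' t *\<^sub>R T t (T h x)))"
      unfolding E_def Th[OF dec(1)] Th[OF dec(2)] shift[symmetric]
      by (simp only: integral_diff[OF integrable_diff[OF int int'(1)] int'(2)] integral_diff[OF int int'(1)]
          integral_cmul)
    also have "\<dots> = integral {0..} (\<lambda>t. (\<phi> (t + h) - \<phi> t - h * \<phi>' t) *\<^sub>R T t (T h x))"
      by (intro integral_cong) (use h in \<open>simp add: \<psi>_def T_add scaleR_diff_left\<close>)
    also have "norm \<dots> \<le> (h\<^sup>2 * (C * exp \<bar>c\<bar>) * M * norm (T h x)) * (exp (- (c - \<omega>) * 0) / (c - \<omega>))"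
    proof (rule norm_integral_exp_bounded)
      show "c - \<omega> > 0" using c by simp
      show "norm ((\<phi> (t + h) - \<phi> t - h * \<phi>' t) *\<^sub>R T t (T h x))
          \<le> h\<^sup>2 * (C * exp \<bar>c\<bar>) * M * norm (T h x) * exp (- (c - \<omega>) * t)" if "t \<ge> 0" for t
        using that h by (intro norm_weighted_orbit exp_decay_increment[OF d1 d2 C]) auto
      have "continuous_on {0..} \<phi>" "continuous_on {0..} \<phi>'" using dec by (auto simp: exp_decay_def)
      moreover from this(1) have "continuous_on {0..} (\<lambda>t. \<phi> (t + h))"
        by (rule continuous_on_compose2) (use h in \<open>auto intro!: continuous_intros\<close>)
      ultimately show "continuous_on {0..} (\<lambda>t. (\<phi> (t + h) - \<phi> t - h * \<phi>' t) *\<^sub>R T t (T h x))"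
        by (intro continuous_intros continuous_T)
    qed
    finally show ?thesis by (simp add: K_def)
  qed
  have "((\<lambda>h. - ((1 / h) *\<^sub>R integral {0..h} \<psi>) - T h (orbit_integral \<phi>' x) - (1 / h) *\<^sub>R E h)
      \<longlongrightarrow> - \<psi> 0 - orbit_integral \<phi>' x - 0) (at_right 0)"
  proof (intro tendsto_diff tendsto_minus tendsto_initial_average[OF cont])
    show "((\<lambda>t. T t (orbit_integral \<phi>' x)) \<longlongrightarrow> orbit_integral \<phi>' x) (at_right 0)"
      by (rule tendsto_T_0)
    show "((\<lambda>h. (1 / h) *\<^sub>R E h) \<longlongrightarrow> 0) (at_right 0)"
    proof (rule Lim_null_comparison)
      show "\<forall>\<^sub>F h in at_right 0. norm ((1 / h) *\<^sub>R E h) \<le> h * K h"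
        using eventually_at_right_0
      proof eventually_elim
        case (elim h)
        then have "norm ((1 / h) *\<^sub>R E h) \<le> (1 / h) * (h\<^sup>2 * K h)"
          using E_bound[of h] by (simp add: divide_simps)
        then show ?case using elim by (simp add: power2_eq_square)
      qed
      have "(K \<longlongrightarrow> C * exp \<bar>c\<bar> * M * norm x / (c - \<omega>)) (at_right 0)"
        unfolding K_def using c by (intro tendsto_intros tendsto_T_0) auto
      from tendsto_mult[OF tendsto_ident_at this]
      show "((\<lambda>h. h * K h) \<longlongrightarrow> 0) (at_right 0)" by simp
    qed
  qed
  moreover have "\<forall>\<^sub>F h in at_right 0. - ((1 / h) *\<^sub>R integral {0..h} \<psi>) - T h (orbit_integral \<phi>' x) - (1 / h) *\<^sub>R E h
      = (1 / h) *\<^sub>R (T h (orbit_integral \<phi> x) - orbit_integral \<phi> x)"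
    using eventually_at_right_0
    by eventually_elim (simp add: E_def algebra_simps)
  ultimately have "((\<lambda>h. (1 / h) *\<^sub>R (T h (orbit_integral \<phi> x) - orbit_integral \<phi> x)) \<longlongrightarrow> - \<psi> 0 - orbit_integral \<phi>' x - 0) (at_right 0)"
    by (rule Lim_transform_eventually)
  then show ?thesis by (simp add: generates_def \<psi>_def T_0)
qed

end

text \<open>Powers of \<open>A\<close> are function iterates of a total function, meaningful only on their
  domains; the following lemmas show that on those domains they are linear.\<close>

locale semigroup_generator = exp_bounded_semigroup T M \<omega>
  for T :: "real \<Rightarrow> 'x::banach \<Rightarrow> 'x" and M \<omega> :: real +
  fixes D :: "'x set" and A :: "'x \<Rightarrow> 'x"
  assumes D_eq: "D = generator_dom T"
    and A_eq: "x \<in> D \<Longrightarrow> A x = generator T x"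
begin

lemma generates_iff: "generates x y \<longleftrightarrow> x \<in> D \<and> A x = y"
  using generates_generator generator_domD A_eq D_eq by metis

lemma power_dom_mono: "x \<in> op_power_dom D A n \<Longrightarrow> k \<le> n \<Longrightarrow> x \<in> op_power_dom D A k"
  by (induction n) (auto simp: le_Suc_eq)

lemma power_add:
  "x \<in> op_power_dom D A k \<Longrightarrow> y \<in> op_power_dom D A k \<Longrightarrow>
    x + y \<in> op_power_dom D A k \<and> (A ^^ k) (x + y) = (A ^^ k) x + (A ^^ k) y"
  by (induction k) (use generates_add in \<open>auto simp: generates_iff\<close>)

lemma power_scaleR:
  "x \<in> op_power_dom D A k \<Longrightarrow>
    r *\<^sub>R x \<in> op_power_dom D A k \<and> (A ^^ k) (r *\<^sub>R x) = r *\<^sub>R (A ^^ k) x"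
  by (induction k) (use generates_scaleR in \<open>auto simp: generates_iff\<close>)

lemma poly_op_eq:
  "x \<in> op_power_dom D A (degree P) \<Longrightarrow> poly_op P A x = (\<Sum>k\<le>degree P. coeff P k *\<^sub>R (A ^^ k) x)"
  unfolding poly_op_def by (intro sum.cong refl) (use power_dom_mono power_scaleR in blast)

lemma power_orbit_integral_commute:
  assumes "exp_decay c \<phi>" "c > \<omega>"
  shows "x \<in> op_power_dom D A k \<Longrightarrow>
    orbit_integral \<phi> x \<in> op_power_dom D A k \<and> (A ^^ k) (orbit_integral \<phi> x) = orbit_integral \<phi> ((A ^^ k) x)"
  by (induction k) (use generates_orbit_integral_commute[OF assms] in \<open>auto simp: generates_iff\<close>)

end

text \<open>\<open>F j\<close> is the \<open>j\<close>-th derivative of a weight \<open>F 0\<close> which solves the initial value problem attached to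
  \<open>P\<close> and decays fast enough for the orbit integrals to converge.\<close>

locale resolvent_kernel = semigroup_generator T M \<omega> D A
  for T :: "real \<Rightarrow> 'x::banach \<Rightarrow> 'x" and M \<omega> :: real and D A +
  fixes F :: "nat \<Rightarrow> real \<Rightarrow> real" and c :: real and P :: "real poly" and m :: nat
  assumes c: "c > \<omega>"
    and degree_P: "degree P = m + 2"
    and F_derivative: "t \<ge> 0 \<Longrightarrow> (F j has_vector_derivative F (Suc j) t) (at t within {0..})"
    and F_decay: "exp_decay c (F j)"
    and F_ode: "t \<ge> 0 \<Longrightarrow> (\<Sum>k\<le>m + 2. (- 1) ^ k * coeff P k * F k t) = 0"
    and F_init: "j \<le> m \<Longrightarrow> F j 0 = 0" "F (m + 1) 0 = (- 1) ^ m * inverse (coeff P (m + 2))"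
begin

lemma generates_orbit_integral_F: "generates (orbit_integral (F k) x) (- (F k 0 *\<^sub>R x) - orbit_integral (F (Suc k)) x)"
  by (rule generates_orbit_integral[OF F_decay F_decay F_decay[of "Suc (Suc k)"] c F_derivative F_derivative])

text \<open>Each application of \<open>A\<close> differentiates the weight and changes the sign; the boundary
  terms vanish because the initial values up to order \<open>m\<close> do.\<close>

lemma power_orbit_integral:
  "k \<le> m + 1 \<Longrightarrow> orbit_integral (F 0) x \<in> op_power_dom D A k \<and>
    (A ^^ k) (orbit_integral (F 0) x) = (- 1) ^ k *\<^sub>R orbit_integral (F k) x"
proof (induction k)
  case (Suc k)
  have "generates ((- 1) ^ k *\<^sub>R orbit_integral (F k) x) ((- 1) ^ k *\<^sub>R (- (F k 0 *\<^sub>R x) - orbit_integral (F (Suc k)) x))"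
    by (intro generates_scaleR generates_orbit_integral_F)
  then show ?case using Suc F_init(1)[of k] by (auto simp: generates_iff)
qed simp

text \<open>The only boundary term that survives comes from the derivative of order
  \<open>m + 1\<close>; its normalisation makes \<open>P(A)\<close> reproduce \<open>x\<close>.\<close>

lemma power_orbit_integral_top:
  "orbit_integral (F 0) x \<in> op_power_dom D A (m + 2) \<and>
    (A ^^ (m + 2)) (orbit_integral (F 0) x) = (- 1) ^ (m + 2) *\<^sub>R orbit_integral (F (m + 2)) x + inverse (coeff P (m + 2)) *\<^sub>R x"
proof -
  have "generates ((- 1) ^ (m + 1) *\<^sub>R orbit_integral (F (m + 1)) x)
      ((- 1) ^ (m + 1) *\<^sub>R (- (F (m + 1) 0 *\<^sub>R x) - orbit_integral (F (Suc (m + 1))) x))"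
    by (intro generates_scaleR generates_orbit_integral_F)
  moreover have "(- 1) ^ m * ((- 1) ^ m * r) = (r :: real)" for r
    by (simp add: mult.assoc[symmetric] power_mult_distrib[symmetric])
  ultimately show ?thesis
    using power_orbit_integral[of "m + 1" x] unfolding F_init(2)
    by (simp add: generates_iff scaleR_diff_right)
qed

text \<open>After the boundary term is split off, what remains is the integral of the
  differential equation against the orbit.\<close>

lemma poly_op_orbit_integral: "poly_op P A (orbit_integral (F 0) x) = x"
proof -
  \<comment> \<open>The leading coefficient is cancelled against its inverse in the last initial value.\<close>
  have lc: "coeff P (m + 2) \<noteq> 0"
    using degree_P by (metis add_2_eq_Suc' leading_coeff_0_iff degree_0 nat.distinct(1))
  have "poly_op P A (orbit_integral (F 0) x) = (\<Sum>k\<le>m + 2. coeff P k *\<^sub>R (A ^^ k) (orbit_integral (F 0) x))"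
    using poly_op_eq[of "orbit_integral (F 0) x" P] power_orbit_integral_top by (simp add: degree_P)
  also have "\<dots> = (\<Sum>k\<le>m + 2. ((- 1) ^ k * coeff P k) *\<^sub>R orbit_integral (F k) x) + x"
  proof -
    have "(\<Sum>k\<le>m + 1. coeff P k *\<^sub>R (A ^^ k) (orbit_integral (F 0) x)) = (\<Sum>k\<le>m + 1. ((- 1) ^ k * coeff P k) *\<^sub>R orbit_integral (F k) x)"
      using power_orbit_integral by (intro sum.cong) (auto simp del: funpow.simps)
    moreover have "coeff P (m + 2) *\<^sub>R (A ^^ (m + 2)) (orbit_integral (F 0) x) = ((- 1) ^ (m + 2) * coeff P (m + 2)) *\<^sub>R orbit_integral (F (m + 2)) x + x"
      unfolding conjunct2[OF power_orbit_integral_top] using lc by (simp add: scaleR_add_right)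
    moreover have "{..m + 2} = insert (m + 2) {..m + 1}" by auto
    ultimately show ?thesis by simp
  qed
  also have "(\<Sum>k\<le>m + 2. ((- 1) ^ k * coeff P k) *\<^sub>R orbit_integral (F k) x)
      = integral {0..} (\<lambda>t. \<Sum>k\<le>m + 2. ((- 1) ^ k * coeff P k) *\<^sub>R (F k t *\<^sub>R T t x))"
    unfolding orbit_integral_def integral_cmul[symmetric]
    by (intro integral_sum[symmetric] integrable_cmul integrable_weighted_orbit[OF F_decay c]) simp
  also have "\<dots> = integral {0::real..} (\<lambda>t. 0)"
  proof (intro integral_cong)
    fix t :: real assume "t \<in> {0..}"
    then have "(\<Sum>k\<le>m + 2. (- 1) ^ k * coeff P k * F k t) *\<^sub>R T t x = 0"
      using F_ode by simp
    then show "(\<Sum>k\<le>m + 2. ((- 1) ^ k * coeff P k) *\<^sub>R (F k t *\<^sub>R T t x)) = 0"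
      by (simp only: scaleR_scaleR scaleR_sum_left)
  qed
  finally show ?thesis by simp
qed

text \<open>The left inverse property: on the domain of the highest power, the orbit
  integral commutes with every power of \<open>A\<close>.\<close>

lemma orbit_integral_poly_op:
  assumes x: "x \<in> op_power_dom D A (m + 2)"
  shows "orbit_integral (F 0) (poly_op P A x) = x"
proof -
  note lin = bounded_linear.linear[OF bounded_linear_orbit_integral[OF F_decay c]]
  have "orbit_integral (F 0) (poly_op P A x) = (\<Sum>k\<le>degree P. coeff P k *\<^sub>R orbit_integral (F 0) ((A ^^ k) x))"
    using poly_op_eq[of x P] x unfolding degree_P
    by (simp only: linear_sum[OF lin] linear_scale[OF lin])
  also have "\<dots> = (\<Sum>k\<le>degree P. coeff P k *\<^sub>R (A ^^ k) (orbit_integral (F 0) x))"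
  proof (intro sum.cong refl)
    fix k assume "k \<in> {..degree P}"
    then have "x \<in> op_power_dom D A k"
      using power_dom_mono[OF x] by (simp add: degree_P)
    from power_orbit_integral_commute[OF F_decay c this]
    show "coeff P k *\<^sub>R orbit_integral (F 0) ((A ^^ k) x) = coeff P k *\<^sub>R (A ^^ k) (orbit_integral (F 0) x)" by simp
  qed
  also have "\<dots> = poly_op P A (orbit_integral (F 0) x)"
    using poly_op_eq[of "orbit_integral (F 0) x" P] power_orbit_integral_top by (simp add: degree_P)
  also have "\<dots> = x" by (rule poly_op_orbit_integral)
  finally show ?thesis .
qed

lemma bij_betw_poly_op: "bij_betw (poly_op P A) (op_power_dom D A (m + 2)) UNIV"
  by (rule bij_betw_byWitness[where f' = "orbit_integral (F 0)"])
     (use orbit_integral_poly_op poly_op_orbit_integral power_orbit_integral_top in auto)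

lemma poly_op_inv_eq: "poly_op_inv P D A = orbit_integral (F 0)"
proof
  fix x
  have "inj_on (poly_op P A) (op_power_dom D A (m + 2))"
    using bij_betw_poly_op by (rule bij_betw_imp_inj_on)
  then show "poly_op_inv P D A x = orbit_integral (F 0) x"
    unfolding poly_op_inv_def degree_P using power_orbit_integral_top poly_op_orbit_integral
    by (intro inv_into_f_eq) auto
qed

end

lemma exp_decay_cmult: "exp_decay c \<phi> \<Longrightarrow> exp_decay c (\<lambda>t. r * \<phi> t)"
proof -
  assume \<phi>: "exp_decay c \<phi>"
  then obtain C where "\<And>t. t \<ge> 0 \<Longrightarrow> \<bar>\<phi> t\<bar> \<le> C * exp (- c * t)" by (auto simp: exp_decay_def)
  then have "\<bar>r * \<phi> t\<bar> \<le> (\<bar>r\<bar> * C) * exp (- c * t)" if "t \<ge> 0" for t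
    unfolding abs_mult mult.assoc using that by (intro mult_left_mono) auto
  then show "exp_decay c (\<lambda>t. r * \<phi> t)"
    using \<phi> by (auto simp: exp_decay_def intro!: continuous_intros)
qed

context exp_bounded_semigroup
begin

lemma orbit_integral_cmult: "orbit_integral (\<lambda>t. r * \<phi> t) x = r *\<^sub>R orbit_integral \<phi> x"
  unfolding orbit_integral_def integral_cmul[symmetric] by simp

text \<open>An integral bound on the weight against \<open>exp (\<omega> t)\<close> instead of a pointwise
  exponential bound; this keeps the powers of \<open>t\<close>, and with them the individual terms of the norm estimate.\<close>

lemma norm_orbit_integral_le:
  assumes \<phi>: "exp_decay c \<phi>" "c > \<omega>"
    and H: "\<And>t. t \<ge> 0 \<Longrightarrow> \<bar>\<phi> t\<bar> \<le> H t"
    and K: "((\<lambda>t. H t * exp (\<omega> * t)) has_integral K) {0..}"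
  shows "norm (orbit_integral \<phi> x) \<le> M * K * norm x"
proof -
  have I: "((\<lambda>t. (M * norm x) * (H t * exp (\<omega> * t))) has_integral (M * norm x) * K) {0..}"
    by (rule has_integral_mult_right[OF K])
  have "norm (orbit_integral \<phi> x) \<le> integral {0..} (\<lambda>t. (M * norm x) * (H t * exp (\<omega> * t)))"
    unfolding orbit_integral_def
  proof (intro integral_norm_bound_integral integrable_weighted_orbit[OF \<phi>] has_integral_integrable[OF I])
    fix t :: real assume "t \<in> {0..}"
    then have t: "t \<ge> 0" by simp
    have "norm (\<phi> t *\<^sub>R T t x) \<le> H t * (M * exp (\<omega> * t) * norm x)"
      unfolding norm_scaleR using H[OF t] norm_T[OF t, of x] order_trans[OF abs_ge_zero H[OF t]]
      by (intro mult_mono) auto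
    then show "norm (\<phi> t *\<^sub>R T t x) \<le> (M * norm x) * (H t * exp (\<omega> * t))" by (simp add: mult_ac)
  qed
  then show ?thesis unfolding integral_unique[OF I] by (simp add: mult_ac)
qed

lemma strong_bochner_integral_weighted_orbits:
  assumes I: "finite I" and \<phi>: "\<And>i. i \<in> I \<Longrightarrow> exp_decay c (\<phi> i)" and c: "c > \<omega>"
    and f: "\<And>t. t \<ge> 0 \<Longrightarrow> f t = (\<Sum>i\<in>I. \<phi> i t *\<^sub>R T t (y i))"
  shows "strong_bochner_integrable (lebesgue_on {0..}) f"
    and "strong_bochner_integral (lebesgue_on {0..}) f = (\<Sum>i\<in>I. orbit_integral (\<phi> i) (y i))"
proof -
  have "\<forall>i\<in>I. \<exists>C. \<forall>t\<ge>0. norm (\<phi> i t *\<^sub>R T t (y i)) \<le> C * exp (- (c - \<omega>) * t)"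
    using exp_bounded_weighted_orbit[OF \<phi>] by metis
  then obtain C where C: "\<And>i t. i \<in> I \<Longrightarrow> t \<ge> 0 \<Longrightarrow> norm (\<phi> i t *\<^sub>R T t (y i)) \<le> C i * exp (- (c - \<omega>) * t)"
    by metis
  have "continuous_on {0..} (\<lambda>t. \<Sum>i\<in>I. \<phi> i t *\<^sub>R T t (y i))"
    by (intro continuous_on_sum continuous_weighted_orbit[OF \<phi>])
  then have cont: "continuous_on {0..} f"
    by (rule continuous_on_eq) (simp add: f)
  have bound: "norm (f t) \<le> (\<Sum>i\<in>I. C i) * exp (- (c - \<omega>) * t)" if "t \<ge> 0" for t
    unfolding f[OF that] sum_distrib_right using C that by (intro sum_norm_le) auto
  have "c - \<omega> > 0" using c by simp
  note * = strong_bochner_integral_half_line[OF cont this bound]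
  show "strong_bochner_integrable (lebesgue_on {0..}) f" by (rule *(1))
  have "integral {0..} f = integral {0..} (\<lambda>t. \<Sum>i\<in>I. \<phi> i t *\<^sub>R T t (y i))"
    by (intro integral_cong) (simp add: f)
  also have "\<dots> = (\<Sum>i\<in>I. orbit_integral (\<phi> i) (y i))"
    unfolding orbit_integral_def by (intro integral_sum I integrable_weighted_orbit[OF \<phi> c])
  finally show "strong_bochner_integral (lebesgue_on {0..}) f = (\<Sum>i\<in>I. orbit_integral (\<phi> i) (y i))"
    using *(2) by simp
qed

text \<open>The operator norm is a supremum of continuous functions of \<open>t\<close>, hence lower semicontinuous,
  even though it need not be continuous.\<close>

lemma onorm_T_borel_measurable: "(\<lambda>t. onorm (T t)) \<in> borel_measurable (lebesgue_on {0..})"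
proof (rule borel_measurableI_greater)
  fix a
  have "{t \<in> {0..}. a < onorm (T t)} = (\<Union>x. {t \<in> {0..}. a < norm (T t x) / norm x})"
  proof -
    have "a < onorm (T t) \<longleftrightarrow> (\<exists>x. a < norm (T t x) / norm x)" if "t \<ge> 0" for t
    proof -
      have "bdd_above (range (\<lambda>x. norm (T t x) / norm x))"
        using le_onorm[OF bounded_linear_T[OF that]] by (auto simp: bdd_above_def)
      then show ?thesis unfolding onorm_def by (simp add: less_cSUP_iff)
    qed
    then show ?thesis by auto
  qed
  also have "openin (top_of_set {0..}) \<dots>"
  proof (intro openin_Union, safe)
    fix x
    have "continuous_on {0..} (\<lambda>t. norm (T t x) / norm x)"
      by (cases "x = 0") (auto intro!: continuous_intros continuous_T)
    then have "openin (top_of_set {0..}) ({0..} \<inter> (\<lambda>t. norm (T t x) / norm x) -` {a<..})"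
      by (rule continuous_openin_preimage_gen) simp
    moreover have "{0..} \<inter> (\<lambda>t. norm (T t x) / norm x) -` {a<..} = {t \<in> {0..}. a < norm (T t x) / norm x}" by auto
    ultimately show "openin (top_of_set {0..}) {t \<in> {0..}. a < norm (T t x) / norm x}" by simp
  qed
  finally have "openin (top_of_set {0..}) {t \<in> {0..}. a < onorm (T t)}" .
  then obtain U where "open U" "{t \<in> {0..}. a < onorm (T t)} = {0..} \<inter> U"
    by (auto simp: openin_open)
  then show "{t \<in> space (lebesgue_on {0..}). a < onorm (T t)} \<in> sets (lebesgue_on {0..})"
    by (auto simp: sets_restrict_space)
qed

lemma laplace_space_weighted_sum:
  fixes q :: "'i \<Rightarrow> 'b::real_normed_vector"
  assumes I: "finite I" and \<phi>: "\<And>i. i \<in> I \<Longrightarrow> exp_decay c (\<phi> i)" and c: "c > \<omega>" and M: "M \<ge> 0"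
    and g: "\<And>t. t \<ge> 0 \<Longrightarrow> g t = (\<Sum>i\<in>I. \<phi> i t *\<^sub>R q i)"
  shows "g \<in> laplace_space T"
proof -
  obtain C where C: "\<And>i t. i \<in> I \<Longrightarrow> t \<ge> 0 \<Longrightarrow> \<bar>\<phi> i t\<bar> \<le> C i * exp (- c * t)"
    using \<phi> unfolding exp_decay_def by metis
  have "continuous_on {0..} (\<lambda>t. \<Sum>i\<in>I. \<phi> i t *\<^sub>R q i)"
    using \<phi> by (intro continuous_on_sum continuous_intros) (auto simp: exp_decay_def)
  then have cont: "continuous_on {0..} g"
    by (rule continuous_on_eq) (simp add: g)
  define B where "B = (\<Sum>i\<in>I. C i * norm (q i))"
  have bound: "norm (g t) \<le> B * exp (- c * t)" if t: "t \<ge> 0" for t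
    unfolding g[OF that] B_def sum_distrib_right
  proof (rule sum_norm_le)
    fix i assume "i \<in> I"
    then have "\<bar>\<phi> i t\<bar> * norm (q i) \<le> (C i * exp (- c * t)) * norm (q i)"
      by (intro mult_right_mono C t) auto
    then show "norm (\<phi> i t *\<^sub>R q i) \<le> C i * norm (q i) * exp (- c * t)" by (simp add: mult_ac)
  qed
  have on: "onorm (T t) \<le> M * exp (\<omega> * t)" "onorm (T t) \<ge> 0" if t: "t \<ge> 0" for t
    using M by (intro onorm_bound norm_T[OF t] mult_nonneg_nonneg) (auto intro: onorm_pos_le bounded_linear_T t)
  have "((\<lambda>t. (M * B) * exp (- (c - \<omega>) * t)) has_integral (M * B) * (exp (- (c - \<omega>) * 0) / (c - \<omega>))) {0..}"
    using c by (intro has_integral_mult_right has_integral_exp_minus_to_infinity) simp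
  moreover have "B \<ge> 0" using order_trans[OF norm_ge_zero bound[of 0]] by simp
  ultimately have "(\<lambda>t. (M * B) * exp (- (c - \<omega>) * t)) absolutely_integrable_on {0..}"
    using M by (intro nonnegative_absolutely_integrable_1) (auto intro: has_integral_integrable)
  then have dom: "integrable (lebesgue_on {0..}) (\<lambda>t. (M * B) * exp (- (c - \<omega>) * t))"
    unfolding set_integrable_def by (rule integrable_restrict_space[THEN iffD2, rotated]) simp
  have "integrable (lebesgue_on {0..}) (\<lambda>t. onorm (T t) * norm (g t))"
  proof (rule Bochner_Integration.integrable_bound[OF dom])
    show "(\<lambda>t. onorm (T t) * norm (g t)) \<in> borel_measurable (lebesgue_on {0..})"
      by (intro borel_measurable_times onorm_T_borel_measurable continuous_imp_measurable_on_sets_lebesgue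
          continuous_intros cont) simp
    show "AE t in lebesgue_on {0..}. norm (onorm (T t) * norm (g t)) \<le> norm ((M * B) * exp (- (c - \<omega>) * t))"
    proof (rule AE_I2)
      fix t assume "t \<in> space (lebesgue_on {0::real..})"
      then have t: "t \<ge> 0" by simp
      have "onorm (T t) * norm (g t) \<le> (M * exp (\<omega> * t)) * (B * exp (- c * t))"
        using M by (intro mult_mono on[OF t] bound[OF t]) auto
      also have "\<dots> = (M * B) * (exp (\<omega> * t) * exp (- c * t))" by simp
      also have "exp (\<omega> * t) * exp (- c * t) = exp (- (c - \<omega>) * t)"
        unfolding exp_add[symmetric] by (simp add: algebra_simps)
      finally show "norm (onorm (T t) * norm (g t)) \<le> norm ((M * B) * exp (- (c - \<omega>) * t))"
        using on(2)[OF t] by simp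
    qed
  qed
  then show ?thesis using cont by (simp add: laplace_space_def)
qed

end

section \<open>Residues of rational functions times exponentials\<close>

abbreviation rational_exp :: "complex poly \<Rightarrow> nat \<Rightarrow> real \<Rightarrow> complex \<Rightarrow> complex" where
  "rational_exp p j t z \<equiv> z ^ j * exp (complex_of_real t * z) / poly p z"

text \<open>The inverse Laplace transform of \<open>1 / p\<close>, and its derivatives with respect to \<open>t\<close>.\<close>

definition residue_kernel :: "complex poly \<Rightarrow> nat \<Rightarrow> real \<Rightarrow> complex" where
  "residue_kernel p j t = (\<Sum>l | poly p l = 0. residue (rational_exp p j t) l)"

lemma residue_sum:
  assumes "open s" "z \<in> s" "finite I" "\<And>i. i \<in> I \<Longrightarrow> f i holomorphic_on s - {z}"
  shows "residue (\<lambda>w. \<Sum>i\<in>I. f i w) z = (\<Sum>i\<in>I. residue (f i) z)"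
  using assms(3,4)
proof (induction I rule: finite_induct)
  case (insert i I)
  then have "residue (\<lambda>w. f i w + (\<Sum>i\<in>I. f i w)) z = residue (f i) z + residue (\<lambda>w. \<Sum>i\<in>I. f i w) z"
    by (intro residue_add[OF assms(1,2)] holomorphic_on_sum) auto
  then show ?case using insert by simp
qed (simp add: residue_const)

text \<open>The point \<open>l\<close> may be a root or a regular point of \<open>p\<close>; in both cases the closed disc contains no
  other root.\<close>

lemma isolating_radius:
  fixes p :: "complex poly"
  assumes "p \<noteq> 0" "r > 0"
  obtains \<epsilon> where "0 < \<epsilon>" "\<epsilon> \<le> r"
    "\<And>z. z \<noteq> l \<Longrightarrow> cmod (z - l) \<le> \<epsilon> \<Longrightarrow> poly p z \<noteq> 0"
proof -
  have fin: "finite ({z. poly p z = 0} - {l})"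
    using poly_roots_finite[OF assms(1)] by simp
  obtain d where d: "d > 0" "\<And>z. z \<in> {z. poly p z = 0} - {l} \<Longrightarrow> d \<le> dist l z"
    using finite_set_avoid[OF fin] by (metis DiffE singletonI)
  show ?thesis
  proof
    show "0 < min (d / 2) r" "min (d / 2) r \<le> r" using d assms by auto
    fix z assume "z \<noteq> l" "cmod (z - l) \<le> min (d / 2) r"
    then show "poly p z \<noteq> 0" using d(1) d(2)[of z] by (force simp: dist_norm norm_minus_commute)
  qed
qed

lemma holomorphic_rational:
  fixes p :: "complex poly"
  assumes "h holomorphic_on UNIV" "\<And>z. z \<in> S \<Longrightarrow> poly p z \<noteq> 0"
  shows "(\<lambda>z. h z / poly p z) holomorphic_on S"
  using assms by (intro holomorphic_on_divide holomorphic_intros) (auto intro: holomorphic_on_subset)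

lemma has_contour_integral_residue:
  fixes p :: "complex poly"
  assumes h: "h holomorphic_on UNIV" and \<epsilon>: "0 < \<epsilon>"
    and ne: "\<And>z. z \<noteq> l \<Longrightarrow> cmod (z - l) \<le> \<epsilon> \<Longrightarrow> poly p z \<noteq> 0" and p: "p \<noteq> 0"
  shows "((\<lambda>z. h z / poly p z) has_contour_integral 2 * pi * \<i> * residue (\<lambda>z. h z / poly p z) l) (circlepath l \<epsilon>)"
proof (rule base_residue)
  let ?S = "- ({z. poly p z = 0} - {l})"
  show "open ?S"
    using poly_roots_finite[OF p] by (intro open_Compl finite_imp_closed) simp
  show "l \<in> ?S" "\<epsilon> > 0" using \<epsilon> by auto
  show "(\<lambda>z. h z / poly p z) holomorphic_on ?S - {l}"
    by (intro holomorphic_rational h) auto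
  show "cball l \<epsilon> \<subseteq> ?S" using ne by (auto simp: dist_norm norm_minus_commute)
qed

text \<open>Differentiation under the integral sign; the integrand is
  smooth in \<open>t\<close> and continuous on the compact circle.\<close>

lemma circle_integral_has_vector_derivative:
  fixes \<phi> :: "complex \<Rightarrow> complex" and \<epsilon> :: real
  assumes \<phi>: "continuous_on (sphere l \<epsilon>) \<phi>" and \<epsilon>: "\<epsilon> > 0"
  shows "((\<lambda>t. contour_integral (circlepath l \<epsilon>) (\<lambda>z. \<phi> z * exp (complex_of_real t * z))) has_vector_derivative
    contour_integral (circlepath l \<epsilon>) (\<lambda>z. z * \<phi> z * exp (complex_of_real t * z))) (at t)"
proof -
  let ?g = "circlepath l \<epsilon>"
  define u where "u x = 2 * pi * \<i> * \<epsilon> * exp (2 * of_real pi * \<i> * x)" for x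
  have path: "?g x \<in> sphere l \<epsilon>" if "x \<in> {0..1}" for x
    using that \<epsilon> path_image_circlepath[of l \<epsilon>] by (auto simp: path_image_def)
  have cont_g: "continuous_on S ?g" for S
    unfolding circlepath_def part_circlepath_def by (intro continuous_intros)
  have cont_u: "continuous_on S (\<lambda>x. u (complex_of_real x))" for S
    unfolding u_def by (intro continuous_intros)
  have eq: "contour_integral ?g f = integral (cbox 0 1) (\<lambda>x. f (?g x) * u x)" for f
    unfolding contour_integral_integral vector_derivative_circlepath u_def by simp
  have \<phi>g: "continuous_on {0..1} (\<lambda>x. \<phi> (?g x))"
    by (rule continuous_on_compose2[OF \<phi> cont_g]) (use path in auto)
  show ?thesis
    unfolding eq
  proof (rule leibniz_rule_vector_derivative[where U = UNIV])
    fix s x :: real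
    have "((\<lambda>s. exp (complex_of_real s * ?g x)) has_vector_derivative ?g x * exp (complex_of_real s * ?g x)) (at s)"
      by (auto intro!: derivative_eq_intros has_vector_derivative_real_field simp: mult.commute)
    then show "((\<lambda>s. \<phi> (?g x) * exp (complex_of_real s * ?g x) * u x) has_vector_derivative
        ?g x * \<phi> (?g x) * exp (complex_of_real s * ?g x) * u x) (at s within UNIV)"
      by (auto intro!: derivative_eq_intros simp: mult_ac)
    show "(\<lambda>x. \<phi> (?g x) * exp (complex_of_real s * ?g x) * u x) integrable_on cbox 0 1"
      using \<phi>g by (intro integrable_continuous continuous_intros cont_g cont_u) simp
  next
    have "continuous_on (UNIV \<times> cbox 0 1) (\<lambda>y. ?g (snd y))" "continuous_on (UNIV \<times> cbox 0 1) (\<lambda>y. u (complex_of_real (snd y)))"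
      "continuous_on (UNIV \<times> cbox 0 1) (\<lambda>y. \<phi> (?g (snd y)))"
      by (auto intro!: continuous_on_compose2[OF cont_g[of UNIV]] continuous_on_compose2[OF cont_u[of UNIV]]
          continuous_on_compose2[OF \<phi>g] continuous_intros)
    then show "continuous_on (UNIV \<times> cbox 0 1)
        (\<lambda>(s, x). ?g x * \<phi> (?g x) * exp (complex_of_real s * ?g x) * u x)"
      unfolding split_beta by (intro continuous_intros)
  qed auto
qed

lemma residue_kernel_has_vector_derivative:
  assumes p: "p \<noteq> 0"
  shows "(residue_kernel p j has_vector_derivative residue_kernel p (Suc j) t) (at t)"
  unfolding residue_kernel_def[abs_def]
proof (rule has_vector_derivative_sum)
  fix l
  obtain \<epsilon> where \<epsilon>: "0 < \<epsilon>" "\<And>z. z \<noteq> l \<Longrightarrow> cmod (z - l) \<le> \<epsilon> \<Longrightarrow> poly p z \<noteq> 0"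
    using isolating_radius[OF p, of 1 l] by (metis zero_less_one)
  have res: "residue (rational_exp p j t) l = contour_integral (circlepath l \<epsilon>) (\<lambda>z. z ^ j / poly p z * exp (complex_of_real t * z)) / (2 * pi * \<i>)" for j t
    using contour_integral_unique[OF has_contour_integral_residue[OF _ \<epsilon> p, of "\<lambda>z. z ^ j * exp (complex_of_real t * z)"]]
    by (simp add: holomorphic_intros)
  have "continuous_on (sphere l \<epsilon>) (\<lambda>z. z ^ j / poly p z)"
    using \<epsilon> by (intro continuous_intros) (force simp: dist_norm norm_minus_commute)
  from has_vector_derivative_divide[OF circle_integral_has_vector_derivative[OF this \<epsilon>(1), of t], of "2 * pi * \<i>"]
  show "((\<lambda>t. residue (rational_exp p j t) l) has_vector_derivative residue (rational_exp p (Suc j) t) l) (at t)"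
    unfolding res by (simp add: mult.assoc)
qed

text \<open>On a circle around a pole \<open>l\<close> of radius at most \<open>- c - Re l\<close> the real part of \<open>z\<close> is at
  most \<open>- c\<close>, which bounds the exponential uniformly on the circle, for poles of every order.\<close>

lemma residue_kernel_decay:
  assumes p: "p \<noteq> 0" and c: "\<And>l. poly p l = 0 \<Longrightarrow> Re l < - c"
  shows "\<exists>C. \<forall>t\<ge>0. cmod (residue_kernel p j t) \<le> C * exp (- c * t)"
proof -
  have "\<exists>C. \<forall>t\<ge>0. cmod (residue (rational_exp p j t) l) \<le> C * exp (- c * t)" if l: "poly p l = 0" for l
  proof -
    obtain \<epsilon> where \<epsilon>: "0 < \<epsilon>" "\<epsilon> \<le> - c - Re l" "\<And>z. z \<noteq> l \<Longrightarrow> cmod (z - l) \<le> \<epsilon> \<Longrightarrow> poly p z \<noteq> 0"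
      using isolating_radius[OF p, of "- c - Re l" l] c[OF l] by auto
    have "continuous_on (sphere l \<epsilon>) (\<lambda>z. z ^ j / poly p z)"
      using \<epsilon> by (intro continuous_intros) (force simp: dist_norm norm_minus_commute)
    then have "bounded ((\<lambda>z. z ^ j / poly p z) ` sphere l \<epsilon>)"
      by (intro compact_imp_bounded compact_continuous_image) auto
    then obtain B where B: "\<And>z. z \<in> sphere l \<epsilon> \<Longrightarrow> cmod (z ^ j / poly p z) \<le> B"
      unfolding bounded_iff by (metis imageI)
    have "B \<ge> 0"
      using order_trans[OF norm_ge_zero B[of "l + of_real \<epsilon>"]] \<epsilon>(1) by (simp add: dist_norm)
    have "cmod (residue (rational_exp p j t) l) \<le> B * \<epsilon> * exp (- c * t)" if t: "t \<ge> 0" for t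
    proof -
      have "cmod (2 * pi * \<i> * residue (rational_exp p j t) l) \<le> B * exp (- c * t) * (2 * pi * \<epsilon>)"
      proof (rule has_contour_integral_bound_circlepath[OF has_contour_integral_residue[OF _ \<epsilon>(1,3) p]])
        fix z assume z: "cmod (z - l) = \<epsilon>"
        have "Re z \<le> - c" using complex_Re_le_cmod[of "z - l"] z \<epsilon>(2) by simp
        then have "cmod (exp (complex_of_real t * z)) \<le> exp (- c * t)"
          using t mult_right_mono[of "Re z" "- c" t] by (simp add: mult.commute)
        then have "cmod (z ^ j / poly p z) * cmod (exp (complex_of_real t * z)) \<le> B * exp (- c * t)"
          using B[of z] z \<open>B \<ge> 0\<close> by (intro mult_mono) (auto simp: dist_norm norm_minus_commute)
        then show "cmod (rational_exp p j t z) \<le> B * exp (- c * t)"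
          by (simp add: norm_mult norm_divide)
      qed (use \<open>B \<ge> 0\<close> \<epsilon> in \<open>auto intro!: holomorphic_intros\<close>)
      then show ?thesis by (simp add: norm_mult mult_ac)
    qed
    then show ?thesis by blast
  qed
  then obtain C where C: "\<And>l t. poly p l = 0 \<Longrightarrow> t \<ge> 0 \<Longrightarrow> cmod (residue (rational_exp p j t) l) \<le> C l * exp (- c * t)"
    by metis
  have "cmod (residue_kernel p j t) \<le> (\<Sum>l | poly p l = 0. C l) * exp (- c * t)" if "t \<ge> 0" for t
    unfolding residue_kernel_def sum_distrib_right using C that by (intro sum_norm_le) auto
  then show ?thesis by blast
qed

text \<open>The combination of the integrands is \<open>p(z) exp (t z) / p(z)\<close>, which has removable
  singularities.\<close>

lemma residue_kernel_ode:
  assumes p: "p \<noteq> 0"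
  shows "(\<Sum>k\<le>degree p. coeff p k * residue_kernel p k t) = 0"
proof -
  have "(\<Sum>k\<le>degree p. coeff p k * residue (rational_exp p k t) l) = 0" for l
  proof -
    obtain \<epsilon> where \<epsilon>: "0 < \<epsilon>" "\<And>z. z \<noteq> l \<Longrightarrow> cmod (z - l) \<le> \<epsilon> \<Longrightarrow> poly p z \<noteq> 0"
      using isolating_radius[OF p, of 1 l] by (metis zero_less_one)
    have hol: "rational_exp p k t holomorphic_on ball l \<epsilon> - {l}" for k
      using \<epsilon> by (intro holomorphic_rational holomorphic_intros) (auto simp: dist_norm norm_minus_commute)
    have "(\<Sum>k\<le>degree p. coeff p k * residue (rational_exp p k t) l)
        = (\<Sum>k\<le>degree p. residue (\<lambda>z. coeff p k * rational_exp p k t z) l)"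
      using \<epsilon>(1) by (intro sum.cong refl residue_lmul[OF _ _ hol, symmetric]) auto
    also have "\<dots> = residue (\<lambda>z. \<Sum>k\<le>degree p. coeff p k * rational_exp p k t z) l"
      using \<epsilon>(1) by (intro residue_sum[of "ball l \<epsilon>", symmetric] holomorphic_on_mult[OF _ hol]) auto
    also have "\<dots> = residue (\<lambda>z. exp (complex_of_real t * z)) l"
    proof (rule residue_cong)
      have "\<forall>\<^sub>F z in at l. z \<in> ball l \<epsilon> \<and> z \<noteq> l"
        using eventually_at_in_open[of "ball l \<epsilon>" l] \<epsilon>(1) by simp
      then show "\<forall>\<^sub>F z in at l. (\<Sum>k\<le>degree p. coeff p k * rational_exp p k t z) = exp (complex_of_real t * z)"
      proof eventually_elim
        case (elim z)
        then have "poly p z \<noteq> 0" using \<epsilon>(2)[of z] by (auto simp: dist_norm norm_minus_commute)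
        moreover have "(\<Sum>k\<le>degree p. coeff p k * rational_exp p k t z) = poly p z * exp (complex_of_real t * z) / poly p z"
          by (simp add: poly_altdef sum_distrib_right sum_divide_distrib mult.assoc)
        ultimately show ?case by simp
      qed
    qed simp
    also have "\<dots> = 0"
      by (rule residue_holo[of UNIV]) (auto intro!: holomorphic_intros)
    finally show ?thesis .
  qed
  then have "(\<Sum>l | poly p l = 0. \<Sum>k\<le>degree p. coeff p k * residue (rational_exp p k t) l) = 0"
    by simp
  then show ?thesis
    unfolding residue_kernel_def sum_distrib_left by (subst sum.swap)
qed

text \<open>In the variable \<open>w = 1 / z\<close> the quotient is continuous at \<open>w = 0\<close>, its denominator being the
  reversed polynomial, whose constant coefficient is the leading coefficient of \<open>p\<close>.\<close>

lemma rational_at_infinity: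
  fixes p :: "complex poly"
  assumes p: "degree p > 0" and j: "Suc j \<le> degree p"
  shows "((\<lambda>z. z ^ Suc j / poly p z) \<longlongrightarrow> (if Suc j = degree p then 1 / lead_coeff p else 0)) at_infinity"
proof -
  define q where "q = reflect_poly p"
  have "poly q 0 = lead_coeff p" by (simp add: q_def poly_0_coeff_0)
  then have q0: "poly q 0 \<noteq> 0" using p by auto
  have "((\<lambda>w. w ^ (degree p - Suc j) / poly q w) \<longlongrightarrow> 0 ^ (degree p - Suc j) / poly q 0) (at 0)"
    using q0 by (intro tendsto_intros) auto
  then have "((\<lambda>w. w ^ (degree p - Suc j) / poly q w) \<longlongrightarrow> 0 ^ (degree p - Suc j) / poly q 0) (nhds 0)"
    using q0 by (intro tendsto_at_iff_tendsto_nhds[THEN iffD1, of "\<lambda>w. w ^ (degree p - Suc j) / poly q w" 0]) simp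
  from filterlim_compose[OF this tendsto_inverse_0]
  have "((\<lambda>z. inverse z ^ (degree p - Suc j) / poly q (inverse z)) \<longlongrightarrow> (if Suc j = degree p then 1 / lead_coeff p else 0)) at_infinity"
    using j \<open>poly q 0 = lead_coeff p\<close> by (cases "Suc j = degree p") (auto simp: power_0_left)
  then show ?thesis
  proof (rule Lim_transform_eventually)
    show "\<forall>\<^sub>F z in at_infinity. inverse z ^ (degree p - Suc j) / poly q (inverse z) = z ^ Suc j / poly p z"
      unfolding eventually_at_infinity
    proof (intro exI[of _ 1] allI impI)
      fix z :: complex assume "1 \<le> norm z"
      then have z: "z \<noteq> 0" by auto
      have "poly q (inverse z) = inverse z ^ degree p * poly p z"
        using poly_reflect_poly_nz[of "inverse z" p] z by (simp add: q_def)
      moreover have "inverse z ^ degree p = inverse z ^ (degree p - Suc j) * inverse z ^ Suc j"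
        using j by (simp only: power_add[symmetric] le_add_diff_inverse2)
      ultimately have "inverse z ^ (degree p - Suc j) / poly q (inverse z)
          = (inverse z ^ (degree p - Suc j) * 1) / (inverse z ^ (degree p - Suc j) * (inverse z ^ Suc j * poly p z))"
        by (simp only: mult.assoc mult_1_right)
      also have "\<dots> = 1 / (inverse z ^ Suc j * poly p z)"
        using z by (intro mult_divide_mult_cancel_left) simp
      also have "\<dots> = z ^ Suc j / poly p z"
        by (simp only: power_inverse divide_inverse inverse_mult_distrib inverse_inverse_eq mult_1_left)
      finally show "inverse z ^ (degree p - Suc j) / poly q (inverse z) = z ^ Suc j / poly p z" .
    qed
  qed
qed

text \<open>At \<open>t = 0\<close> the integrand is rational, and the sum of its residues is the integral
  over any large circle, divided by \<open>2 \<pi> \<i>\<close>. There \<open>z\<^sup>j / p(z)\<close> is \<open>L / z\<close> up to \<open>o(1 / \<bar>z\<bar>)\<close>, so the sum of residues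
  is \<open>L\<close>.\<close>

lemma residue_kernel_initial:
  assumes p: "degree p > 0" and j: "Suc j \<le> degree p"
  shows "residue_kernel p j 0 = (if Suc j = degree p then 1 / lead_coeff p else 0)"
proof -
  define L where "L = (if Suc j = degree p then 1 / lead_coeff p else 0)"
  define f where "f z = z ^ j / poly p z" for z
  let ?Z = "{l. poly p l = 0}"
  have p0: "p \<noteq> 0" using p by auto
  have fin: "finite ?Z" by (rule poly_roots_finite[OF p0])
  have "cmod (residue_kernel p j 0 - L) \<le> e" if e: "e > 0" for e
  proof -
    have "\<forall>\<^sub>F z in at_infinity. dist (z ^ Suc j / poly p z) L < e"
      unfolding L_def using tendstoD[OF rational_at_infinity[OF p j] e] .
    then obtain b where b: "\<And>z. norm z \<ge> b \<Longrightarrow> dist (z ^ Suc j / poly p z) L < e"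
      unfolding eventually_at_infinity by blast
    obtain b' where b': "\<And>z. z \<in> ?Z \<Longrightarrow> cmod z \<le> b'"
      using finite_imp_bounded[OF fin] by (auto simp: bounded_iff)
    define R where "R = max 1 (max b (b' + 1))"
    have R: "R > 0" "R \<ge> b" "\<And>z. z \<in> ?Z \<Longrightarrow> cmod z < R"
      using b' by (force simp: R_def)+
    have im: "path_image (circlepath 0 R) = {z. cmod z = R}"
      using R(1) by (auto simp: dist_norm)
    have hol: "f holomorphic_on - ?Z"
      unfolding f_def by (intro holomorphic_rational holomorphic_intros) auto
    have "contour_integral (circlepath 0 R) f = 2 * pi * \<i> * (\<Sum>l\<in>?Z. winding_number (circlepath 0 R) l * residue f l)"
    proof (rule Residue_theorem[of UNIV])
      show "path_image (circlepath 0 R) \<subseteq> UNIV - ?Z" unfolding im using R(3) by force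
    qed (use fin hol in \<open>auto simp: Compl_eq_Diff_UNIV\<close>)
    also have "(\<Sum>l\<in>?Z. winding_number (circlepath 0 R) l * residue f l) = residue_kernel p j 0"
      unfolding residue_kernel_def using R(3)
      by (intro sum.cong) (auto simp: winding_number_circlepath f_def[abs_def])
    finally have I1: "contour_integral (circlepath 0 R) f = 2 * pi * \<i> * residue_kernel p j 0" .
    have "f contour_integrable_on circlepath 0 R"
      using R(3) fin by (intro contour_integrable_holomorphic_simple[OF hol]) (auto simp: im finite_imp_closed open_Compl simp del: path_image_circlepath)
    then have "(f has_contour_integral 2 * pi * \<i> * residue_kernel p j 0) (circlepath 0 R)"
      using I1 has_contour_integral_integral by metis
    \<comment> \<open>Subtract \<open>L / z\<close>, whose integral over the circle is known; the rest is at most \<open>e / R\<close> on a circle of length \<open>2 \<pi> R\<close>.\<close>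
    moreover have "((\<lambda>z. L / (z - 0)) has_contour_integral 2 * pi * \<i> * L) (circlepath 0 R)"
      using Cauchy_integral_circlepath_simple[of "\<lambda>_. L" 0 R 0] R(1) by simp
    ultimately have "((\<lambda>z. f z - L / (z - 0)) has_contour_integral (2 * pi * \<i> * residue_kernel p j 0 - 2 * pi * \<i> * L)) (circlepath 0 R)"
      by (rule has_contour_integral_diff)
    then have "cmod (2 * pi * \<i> * residue_kernel p j 0 - 2 * pi * \<i> * L) \<le> e / R * (2 * pi * R)"
    proof (rule has_contour_integral_bound_circlepath)
      fix z assume "cmod (z - 0) = R"
      then have z: "cmod z = R" by simp
      then have z0: "z \<noteq> 0" using R(1) by auto
      have "f z - L / (z - 0) = (z ^ Suc j / poly p z - L) / z"
        using z0 by (simp add: f_def diff_divide_distrib)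
      then have "cmod (f z - L / (z - 0)) = dist (z ^ Suc j / poly p z) L / R"
        by (simp only: norm_divide z dist_norm)
      also have "\<dots> \<le> e / R" using b[of z] z R by (intro divide_right_mono) auto
      finally show "cmod (f z - L / (z - 0)) \<le> e / R" .
    qed (use e R in auto)
    also have "2 * pi * \<i> * residue_kernel p j 0 - 2 * pi * \<i> * L = 2 * pi * \<i> * (residue_kernel p j 0 - L)"
      by (simp add: algebra_simps)
    finally show ?thesis using R(1) by (simp add: norm_mult)
  qed
  then have "cmod (residue_kernel p j 0 - L) \<le> 0"
    by (rule field_le_epsilon) (simp only: add_0)
  then show ?thesis by (simp add: L_def)
qed

text \<open>Replace \<open>exp (t z)\<close> by \<open>exp (t l)\<close> times the Taylor polynomial of degree \<open>n\<close> of \<open>exp (t (z - l))\<close>.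
  The error vanishes at \<open>l\<close> to order \<open>n + 1\<close>, the order of the pole, so it does not contribute
  to the residue.\<close>

lemma residue_exp_expansion:
  fixes p q :: "complex poly"
  assumes p: "\<And>z. poly p z = (z - l) ^ Suc n * poly q z" and q: "poly q l \<noteq> 0"
  shows "residue (\<lambda>z. exp (of_real t * z) / poly p z) l
    = (\<Sum>k\<le>n. residue (\<lambda>z. (z - l) ^ k / poly p z) l * of_real (t ^ k / fact k) * exp (of_real t * l))"
proof -
  have "q \<noteq> 0" using q by auto
  then obtain \<epsilon> where \<epsilon>: "0 < \<epsilon>" and ne: "\<And>z. z \<noteq> l \<Longrightarrow> cmod (z - l) \<le> \<epsilon> \<Longrightarrow> poly q z \<noteq> 0"
    using isolating_radius[of q 1 l] by (metis zero_less_one)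
  let ?B = "ball l \<epsilon>"
  have B: "open ?B" "l \<in> ?B" using \<epsilon> by auto
  have pne: "poly p z \<noteq> 0" if "z \<in> ?B - {l}" for z
    using that ne[of z] by (auto simp: p dist_norm norm_minus_commute)
  define a where "a k = of_real (t ^ k / fact k) * exp (of_real t * l)" for k
  define f where "f z = exp (of_real t * z) / poly p z" for z
  define S where "S z = (\<Sum>k\<le>n. a k * ((z - l) ^ k / poly p z))" for z
  have hol_pow: "(\<lambda>z. (z - l) ^ k / poly p z) holomorphic_on ?B - {l}" for k
    by (intro holomorphic_rational holomorphic_intros pne)
  have hol_S: "S holomorphic_on ?B - {l}"
    unfolding S_def by (intro holomorphic_intros hol_pow)
  have hol_f: "f holomorphic_on ?B - {l}"
    unfolding f_def by (intro holomorphic_rational holomorphic_intros pne)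
  have "residue (\<lambda>z. f z - S z) l = 0"
  proof (rule residue_simple'[OF B holomorphic_on_diff[OF hol_f hol_S]], rule Lim_null_comparison)
    let ?b = "\<lambda>z. cmod (exp (of_real t * l)) * (exp \<bar>Re (of_real t * (z - l))\<bar> * \<bar>t\<bar> ^ Suc n / fact n) / cmod (poly q z) * cmod (z - l)"
    show "\<forall>\<^sub>F z in at l. cmod ((f z - S z) * (z - l)) \<le> ?b z"
      using eventually_at_in_open[OF B]
    proof eventually_elim
      case (elim z)
      define u where "u = of_real t * (z - l)"
      have z: "z \<noteq> l" "poly q z \<noteq> 0" using elim pne[of z] by (auto simp: p)
      have "exp (of_real t * z) = exp (of_real t * l) * exp u"
        unfolding exp_add[symmetric] u_def by (simp add: algebra_simps)
      moreover have "S z = exp (of_real t * l) * (\<Sum>k\<le>n. u ^ k / fact k) / poly p z"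
        unfolding S_def a_def sum_distrib_left sum_divide_distrib
        by (intro sum.cong refl) (simp add: u_def power_mult_distrib mult_ac)
      ultimately have "f z - S z = exp (of_real t * l) * (exp u - (\<Sum>k\<le>n. u ^ k / fact k)) / poly p z"
        by (simp add: f_def right_diff_distrib diff_divide_distrib)
      then have "cmod ((f z - S z) * (z - l))
          = cmod (exp (of_real t * l)) * cmod (exp u - (\<Sum>k\<le>n. u ^ k / fact k)) / cmod (poly p z) * cmod (z - l)"
        by (simp only: norm_mult norm_divide)
      also have "\<dots> \<le> cmod (exp (of_real t * l)) * (exp \<bar>Re u\<bar> * cmod u ^ Suc n / fact n) / cmod (poly p z) * cmod (z - l)"
        by (intro mult_right_mono divide_right_mono mult_left_mono Taylor_exp) auto
      also have "cmod u ^ Suc n = \<bar>t\<bar> ^ Suc n * cmod (z - l) ^ Suc n"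
        by (simp only: u_def norm_mult norm_of_real power_mult_distrib)
      also have "cmod (exp (of_real t * l)) * (exp \<bar>Re u\<bar> * (\<bar>t\<bar> ^ Suc n * cmod (z - l) ^ Suc n) / fact n) / cmod (poly p z) * cmod (z - l)
          = ?b z"
        using z unfolding p norm_mult norm_power u_def[symmetric] by (simp del: power_Suc)
      finally show ?case .
    qed
    have "(?b \<longlongrightarrow> cmod (exp (of_real t * l)) * (exp \<bar>Re (of_real t * (l - l))\<bar> * \<bar>t\<bar> ^ Suc n / fact n) / cmod (poly q l) * cmod (l - l)) (at l)"
      using q by (intro tendsto_intros) auto
    then show "(?b \<longlongrightarrow> 0) (at l)" by simp
  qed
  then have "residue f l = residue S l"
    using residue_diff[OF B hol_f hol_S] by simp
  also have "\<dots> = (\<Sum>k\<le>n. residue (\<lambda>z. a k * ((z - l) ^ k / poly p z)) l)"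
    unfolding S_def by (intro residue_sum[OF B] holomorphic_intros hol_pow) auto
  also have "\<dots> = (\<Sum>k\<le>n. a k * residue (\<lambda>z. (z - l) ^ k / poly p z) l)"
    by (intro sum.cong refl residue_lmul[OF B hol_pow])
  finally show ?thesis
    by (simp add: f_def[abs_def] a_def mult_ac)
qed

section \<open>Uniqueness for the initial value problem\<close>

text \<open>Derivatives within the half-line are unique, also at the end point \<open>0\<close>.\<close>

lemma trivial_limit_half_line: "t \<ge> 0 \<Longrightarrow> at t within {0::real..} \<noteq> bot"
proof
  assume t: "t \<ge> 0" and bot: "at t within {0..} = bot"
  have "at_right t \<le> at t within {0..}"
    using t by (intro at_le) auto
  then show False using bot by (simp add: bot_unique)
qed

lemma half_line_deriv_unique:
  assumes "(f has_vector_derivative d) (at t within {0..})" "t \<ge> 0"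
  shows "half_line_deriv f t = d"
  unfolding half_line_deriv_def
  by (rule vector_derivative_within[OF trivial_limit_half_line[OF assms(2)] assms(1)])

lemma half_line_deriv_power_eq:
  assumes F: "\<And>j t. t \<ge> 0 \<Longrightarrow> (F j has_vector_derivative F (Suc j) t) (at t within {0..})"
    and g: "\<And>t. t \<ge> 0 \<Longrightarrow> g t = F 0 t"
  shows "t \<ge> 0 \<Longrightarrow> (half_line_deriv ^^ j) g t = F j t"
proof (induction j arbitrary: t)
  case (Suc j)
  have "((half_line_deriv ^^ j) g has_vector_derivative F (Suc j) t) (at t within {0..})"
    by (rule has_vector_derivative_transform[OF _ _ F]) (use Suc in auto)
  then show ?case using Suc.prems by (simp add: half_line_deriv_unique)
qed (simp add: g)

lemma has_half_line_deriv:
  assumes "smooth_on_half_line g" "t \<ge> 0"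
  shows "((half_line_deriv ^^ j) g has_vector_derivative (half_line_deriv ^^ Suc j) g t) (at t within {0..})"
proof -
  have "(half_line_deriv ^^ j) g differentiable (at t within {0..})"
    using assms by (simp add: smooth_on_half_line_def differentiable_on_def)
  then show ?thesis by (simp add: vector_derivative_works half_line_deriv_def)
qed

text \<open>The energy \<open>E = \<Sum> u\<^sub>j\<^sup>2\<close> satisfies \<open>E' \<le> C E\<close>, because each product \<open>u\<^sub>j u\<^sub>k\<close> is at most \<open>E\<close>;
  hence \<open>E exp (- C t)\<close> is nonincreasing, nonnegative and zero at \<open>0\<close>.\<close>

lemma linear_ode_zero:
  fixes u :: "nat \<Rightarrow> real \<Rightarrow> real"
  assumes der: "\<And>j t. t \<ge> 0 \<Longrightarrow> (u j has_vector_derivative u (Suc j) t) (at t within {0..})"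
    and ode: "\<And>t. t \<ge> 0 \<Longrightarrow> u n t = (\<Sum>k<n. b k * u k t)"
    and init: "\<And>j. j < n \<Longrightarrow> u j 0 = 0"
    and n: "n > 0" and t: "t \<ge> 0"
  shows "u 0 t = 0"
proof -
  define E where "E t = (\<Sum>j<n. (u j t)\<^sup>2)" for t
  define E' where "E' t = (\<Sum>j<n. 2 * (u j t * u (Suc j) t))" for t
  define B where "B = (\<Sum>k<n. \<bar>b k\<bar>)"
  define C where "C = real n * (2 + 2 * B)"
  have E_nonneg: "E t \<ge> 0" for t by (simp add: E_def sum_nonneg)
  have E_der: "(E has_real_derivative E' t) (at t within {0..})" if "t \<ge> 0" for t
  proof -
    have "((\<lambda>t. (u j t)\<^sup>2) has_real_derivative 2 * (u j t * u (Suc j) t)) (at t within {0..})" for j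
      using DERIV_power[OF der[OF that, of j, folded has_real_derivative_iff_has_vector_derivative], of 2]
      by (simp add: mult_ac)
    then show ?thesis unfolding E_def E'_def by (intro DERIV_sum)
  qed
  have sq: "(u j t)\<^sup>2 \<le> E t" if "j < n" for j t
    unfolding E_def using that by (intro member_le_sum) auto
  have prod: "2 * \<bar>u j t * u k t\<bar> \<le> 2 * E t" if "j < n" "k < n" for j k t
  proof -
    have "2 * \<bar>u j t\<bar> * \<bar>u k t\<bar> \<le> \<bar>u j t\<bar>\<^sup>2 + \<bar>u k t\<bar>\<^sup>2"
      by (rule sum_squares_bound)
    then show ?thesis using sq[OF that(1), of t] sq[OF that(2), of t] by (simp add: abs_mult)
  qed
  have E'_le: "E' t \<le> C * E t" if t: "t \<ge> 0" for t
  proof -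
    have "2 * (u j t * u (Suc j) t) \<le> (2 + 2 * B) * E t" if j: "j < n" for j
    proof (cases "Suc j = n")
      case False
      then have "2 * (u j t * u (Suc j) t) \<le> 2 * E t" using prod[of j "Suc j" t] j by simp
      also have "\<dots> \<le> (2 + 2 * B) * E t"
        using E_nonneg by (intro mult_right_mono) (auto simp: B_def sum_nonneg)
      finally show ?thesis .
    next
      case True
      have "2 * (u j t * u (Suc j) t) = (\<Sum>k<n. b k * (2 * (u j t * u k t)))"
        unfolding True ode[OF t] by (simp add: sum_distrib_left mult_ac)
      also have "\<dots> \<le> (\<Sum>k<n. \<bar>b k\<bar> * (2 * E t))"
      proof (rule sum_mono)
        fix k assume k: "k \<in> {..<n}"
        have "b k * (2 * (u j t * u k t)) \<le> \<bar>b k\<bar> * (2 * \<bar>u j t * u k t\<bar>)"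
          using abs_ge_self[of "b k * (2 * (u j t * u k t))"] by (simp add: abs_mult)
        also have "\<dots> \<le> \<bar>b k\<bar> * (2 * E t)" using prod[OF j, of k t] k by (intro mult_left_mono) auto
        finally show "b k * (2 * (u j t * u k t)) \<le> \<bar>b k\<bar> * (2 * E t)" .
      qed
      also have "\<dots> = 2 * B * E t" by (simp add: B_def sum_distrib_right sum_distrib_left mult_ac)
      also have "\<dots> \<le> (2 + 2 * B) * E t" using E_nonneg[of t] by (simp add: algebra_simps)
      finally show ?thesis .
    qed
    then have "E' t \<le> (\<Sum>j<n. (2 + 2 * B) * E t)" unfolding E'_def by (intro sum_mono) simp
    then show ?thesis by (simp add: C_def mult.assoc)
  qed
  define w where "w s = E s * exp (- C * s)" for s
  have w_der: "(w has_real_derivative (E' s - C * E s) * exp (- C * s)) (at s within {0..})" if "s \<ge> 0" for s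
  proof -
    have "((\<lambda>s. exp (- C * s)) has_real_derivative - C * exp (- C * s)) (at s within {0..})"
      by (auto intro!: derivative_eq_intros)
    from DERIV_mult[OF E_der[OF that] this] show ?thesis
      unfolding w_def by (rule DERIV_cong) (simp add: algebra_simps)
  qed
  have "w t \<le> w 0"
  proof (cases "t = 0")
    case False
    with t have "0 < t" by simp
    moreover have "(w has_derivative (\<lambda>v. (E' s - C * E s) * exp (- C * s) * v)) (at s within {0..t})" if "s \<in> {0..t}" for s
      using DERIV_subset[OF w_der, of s "{0..t}"] that by (auto simp: has_field_derivative_def)
    ultimately obtain s where s: "s \<in> {0<..<t}" "w t - w 0 = (E' s - C * E s) * exp (- C * s) * (t - 0)"
      using mvt_simple[of 0 t w "\<lambda>s v. (E' s - C * E s) * exp (- C * s) * v"] by auto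
    have "(E' s - C * E s) * exp (- C * s) * (t - 0) \<le> 0"
      using E'_le[of s] s(1) t by (intro mult_nonpos_nonneg) auto
    then show ?thesis using s(2) by simp
  qed simp
  moreover have "w 0 = 0" using init by (simp add: w_def E_def)
  ultimately have "E t \<le> 0" by (simp add: w_def mult_le_0_iff)
  then have "(u 0 t)\<^sup>2 \<le> 0" using sq[of 0 t] n by linarith
  then show ?thesis by simp
qed

lemma solves_gP_problem_unique:
  assumes P: "degree P = m + 2" and f: "solves_gP_problem m P f" and g: "solves_gP_problem m P g"
    and t: "t \<ge> 0"
  shows "f t = g t"
proof -
  define u where "u j t = (half_line_deriv ^^ j) f t - (half_line_deriv ^^ j) g t" for j t
  define a where "a k = (- 1) ^ k * coeff P k" for k
  have a: "a (m + 2) \<noteq> 0"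
    using P by (metis a_def add_2_eq_Suc' leading_coeff_0_iff degree_0 nat.distinct(1) mult_eq_0_iff power_not_zero neg_equal_0_iff_equal zero_neq_one)
  have "u 0 t = 0"
  proof (rule linear_ode_zero[where u = u and n = "m + 2" and b = "\<lambda>k. - (a k / a (m + 2))"])
    show "(u j has_vector_derivative u (Suc j) t) (at t within {0..})" if "t \<ge> 0" for j t
      unfolding u_def[abs_def] using f g that
      by (intro has_vector_derivative_diff has_half_line_deriv) (auto simp: solves_gP_problem_def)
    show "u (m + 2) t = (\<Sum>k<m + 2. - (a k / a (m + 2)) * u k t)" if "t \<ge> 0" for t
    proof -
      have "(\<Sum>k\<le>m + 2. a k * u k t) = (\<Sum>k\<le>m + 2. a k * (half_line_deriv ^^ k) f t) - (\<Sum>k\<le>m + 2. a k * (half_line_deriv ^^ k) g t)"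
        unfolding sum_subtractf[symmetric] u_def by (intro sum.cong refl) (rule right_diff_distrib)
      also have "\<dots> = 0"
        using f g that unfolding solves_gP_problem_def a_def by (simp only: diff_self)
      finally have "(\<Sum>k<m + 2. a k * u k t) + a (m + 2) * u (m + 2) t = 0"
        unfolding lessThan_Suc_atMost[symmetric] by (simp only: sum.lessThan_Suc)
      then have "a (m + 2) * u (m + 2) t = - (\<Sum>k<m + 2. a k * u k t)" by linarith
      then have "u (m + 2) t = - (\<Sum>k<m + 2. a k * u k t) / a (m + 2)"
        using a by (metis nonzero_mult_div_cancel_left)
      also have "\<dots> = (\<Sum>k<m + 2. - (a k / a (m + 2)) * u k t)"
        unfolding sum_negf[symmetric] sum_divide_distrib by (intro sum.cong refl) simp
      finally show ?thesis .
    qed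
    show "u j 0 = 0" if "j < m + 2" for j
    proof (cases "j \<le> m")
      case False
      then have "j = m + 1" using that by simp
      then show ?thesis using f g by (simp add: u_def solves_gP_problem_def del: funpow.simps)
    qed (use f g in \<open>simp add: u_def solves_gP_problem_def\<close>)
  qed (use t in auto)
  then show ?thesis by (simp add: u_def)
qed

text \<open>A family of successive derivatives that satisfies the equation and the initial conditions
  provides existence; together with uniqueness it makes the definite description in \<open>gP\<close> meaningful.\<close>

lemma gP_eq:
  assumes P: "degree P = m + 2"
    and F: "\<And>j t. t \<ge> 0 \<Longrightarrow> (F j has_vector_derivative F (Suc j) t) (at t within {0..})"
    and ode: "\<And>t. t \<ge> 0 \<Longrightarrow> (\<Sum>k\<le>m + 2. (- 1) ^ k * coeff P k * F k t) = 0"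
    and init: "\<And>j. j \<le> m \<Longrightarrow> F j 0 = 0" "F (m + 1) 0 = (- 1) ^ m * inverse (coeff P (m + 2))"
    and t: "t \<ge> 0"
  shows "(half_line_deriv ^^ j) (gP m P) t = F j t"
proof -
  define g where "g t = (if t < 0 then 0 else F 0 t)" for t
  have g0: "g t = F 0 t" if "t \<ge> 0" for t using that by (simp add: g_def)
  note hld = half_line_deriv_power_eq[OF F g0]
  have "smooth_on_half_line g"
    unfolding smooth_on_half_line_def differentiable_on_def
  proof (intro allI ballI)
    fix j and t :: real assume t: "t \<in> {0..}"
    then have "((half_line_deriv ^^ j) g has_vector_derivative F (Suc j) t) (at t within {0..})"
      by (intro has_vector_derivative_transform[OF _ _ F]) (auto simp: hld)
    then show "(half_line_deriv ^^ j) g differentiable (at t within {0..})"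
      by (rule differentiableI_vector)
  qed
  then have solves: "solves_gP_problem m P g"
    using ode init hld unfolding solves_gP_problem_def by (simp del: funpow.simps sum.atMost_Suc)
  have "gP m P = g"
    unfolding gP_def
  proof (rule the_equality)
    show "solves_gP_problem m P g \<and> (\<forall>t<0. g t = 0)" using solves by (simp add: g_def)
    fix f assume "solves_gP_problem m P f \<and> (\<forall>t<0. f t = 0)"
    then show "f = g"
      using solves_gP_problem_unique[OF P _ solves, of f] by (intro ext) (auto simp: g_def not_less)
  qed
  then show ?thesis using hld t by simp
qed

section \<open>The fundamental solution of a polynomial\<close>

lemma degree_cpoly: "degree (cpoly P) = degree P"
  by (rule degree_map_poly) simp

lemma cpoly_nonzero: "degree P > 0 \<Longrightarrow> cpoly P \<noteq> 0"
  using degree_cpoly[of P] by auto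

text \<open>The polynomial \<open>P(-z)\<close>, the denominator of the Laplace transform.\<close>

definition reflected_cpoly :: "real poly \<Rightarrow> complex poly" where
  "reflected_cpoly P = pcompose (cpoly P) [:0, - 1:]"

lemma poly_reflected_cpoly: "poly (reflected_cpoly P) z = poly (cpoly P) (- z)"
  by (simp add: reflected_cpoly_def poly_pcompose)

lemma coeff_reflected_cpoly: "coeff (reflected_cpoly P) k = of_real ((- 1) ^ k * coeff P k)"
  by (simp add: reflected_cpoly_def coeff_pcompose_linear coeff_map_poly)

lemma degree_reflected_cpoly: "degree (reflected_cpoly P) = degree P"
  by (simp add: reflected_cpoly_def degree_pcompose degree_cpoly)

lemma reflected_cpoly_nonzero: "degree P > 0 \<Longrightarrow> reflected_cpoly P \<noteq> 0"
  using degree_reflected_cpoly[of P] by auto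

lemma roots_reflected_cpoly: "{l. poly (reflected_cpoly P) l = 0} = uminus ` complex_roots P"
  by (force simp: poly_reflected_cpoly complex_roots_def image_iff)

text \<open>The real part of a complex solution solves the same problem because the coefficients and
  the initial values are real. This avoids showing that the residues at conjugate
  poles add up to a real number.\<close>

definition fundamental_solution :: "real poly \<Rightarrow> nat \<Rightarrow> real \<Rightarrow> real" where
  "fundamental_solution P j t = Re (residue_kernel (reflected_cpoly P) j t)"

lemma finite_complex_roots: "degree P > 0 \<Longrightarrow> finite (complex_roots P)"
  unfolding complex_roots_def by (intro poly_roots_finite cpoly_nonzero)

lemma min_re_root_le: "degree P > 0 \<Longrightarrow> l \<in> complex_roots P \<Longrightarrow> min_re_root P \<le> Re l"
  unfolding min_re_root_def using finite_complex_roots by (intro Min_le) auto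

lemma fundamental_solution_has_vector_derivative:
  assumes "degree P > 0"
  shows "(fundamental_solution P j has_vector_derivative fundamental_solution P (Suc j) t) (at t within S)"
proof -
  have "reflected_cpoly P \<noteq> 0" using assms by (rule reflected_cpoly_nonzero)
  from has_vector_derivative_at_within[OF residue_kernel_has_vector_derivative[OF this]]
  show ?thesis unfolding fundamental_solution_def[abs_def] by (rule bounded_linear.has_vector_derivative[OF bounded_linear_Re])
qed

lemma exp_decay_fundamental_solution:
  assumes P: "degree P > 0" and c: "c < min_re_root P"
  shows "exp_decay c (fundamental_solution P j)"
proof -
  have ne: "reflected_cpoly P \<noteq> 0" using P by (rule reflected_cpoly_nonzero)
  have "Re l < - c" if "poly (reflected_cpoly P) l = 0" for l
    using min_re_root_le[OF P, of "- l"] that c by (simp add: complex_roots_def poly_reflected_cpoly)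
  from residue_kernel_decay[OF ne this] obtain C where
    C: "\<And>t. t \<ge> 0 \<Longrightarrow> cmod (residue_kernel (reflected_cpoly P) j t) \<le> C * exp (- c * t)" by blast
  have "\<bar>fundamental_solution P j t\<bar> \<le> C * exp (- c * t)" if "t \<ge> 0" for t
    unfolding fundamental_solution_def by (rule order_trans[OF abs_Re_le_cmod C[OF that]])
  moreover have "continuous_on {0..} (fundamental_solution P j)"
    using fundamental_solution_has_vector_derivative[OF P]
    by (intro continuous_on_vector_derivative) blast
  ultimately show ?thesis unfolding exp_decay_def by blast
qed

lemma fundamental_solution_ode:
  assumes P: "degree P > 0"
  shows "(\<Sum>k\<le>degree P. (- 1) ^ k * coeff P k * fundamental_solution P k t) = 0"
proof -
  have ne: "reflected_cpoly P \<noteq> 0" using P by (rule reflected_cpoly_nonzero)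
  have "Re (\<Sum>k\<le>degree P. of_real ((- 1) ^ k * coeff P k) * residue_kernel (reflected_cpoly P) k t) = 0"
    using residue_kernel_ode[OF ne, of t] unfolding coeff_reflected_cpoly degree_reflected_cpoly by simp
  then show ?thesis unfolding Re_sum fundamental_solution_def scaleR_conv_of_real[symmetric] by simp
qed

lemma fundamental_solution_initial:
  assumes "Suc j \<le> degree P"
  shows "fundamental_solution P j 0 = (if Suc j = degree P then (- 1) ^ Suc j * inverse (coeff P (Suc j)) else 0)"
proof -
  have "residue_kernel (reflected_cpoly P) j 0 = (if Suc j = degree P then 1 / of_real ((- 1) ^ Suc j * coeff P (Suc j)) else 0)"
    using residue_kernel_initial[of "reflected_cpoly P" j] assms by (auto simp: degree_reflected_cpoly coeff_reflected_cpoly simp del: of_real_mult power_Suc)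
  also have "\<dots> = of_real (if Suc j = degree P then (- 1) ^ Suc j * inverse (coeff P (Suc j)) else 0)"
    by (auto simp: divide_inverse power_inverse[symmetric] simp del: power_Suc)
  finally show ?thesis unfolding fundamental_solution_def by (simp only: Re_complex_of_real)
qed

text \<open>Each pole contributes its Laurent coefficients times monomials and an exponential;
  all exponentials are compared with the slowest one, of rate \<open>min_re_root P\<close>.\<close>

lemma fundamental_solution_bound:
  assumes P: "degree P > 0" and t: "t \<ge> 0"
  shows "\<bar>fundamental_solution P 0 t\<bar> \<le> (\<Sum>l\<in>complex_roots P. \<Sum>k = 1..order l (cpoly P).
      cmod (laurent_coeff P l k) * (t ^ (k - 1) / fact (k - 1) * exp (- min_re_root P * t)))"
proof -
  have "residue_kernel (reflected_cpoly P) 0 t = (\<Sum>l\<in>complex_roots P. residue (\<lambda>z. exp (of_real t * z) / poly (reflected_cpoly P) z) (- l))"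
    unfolding residue_kernel_def roots_reflected_cpoly by (subst sum.reindex) (auto simp: inj_on_def)
  then have "\<bar>fundamental_solution P 0 t\<bar> \<le> cmod (\<Sum>l\<in>complex_roots P. residue (\<lambda>z. exp (of_real t * z) / poly (reflected_cpoly P) z) (- l))"
    unfolding fundamental_solution_def by (metis abs_Re_le_cmod)
  also have "\<dots> \<le> (\<Sum>l\<in>complex_roots P. \<Sum>k = 1..order l (cpoly P).
      cmod (laurent_coeff P l k) * (t ^ (k - 1) / fact (k - 1) * exp (- min_re_root P * t)))"
  proof (rule sum_norm_le)
    fix l assume l: "l \<in> complex_roots P"
    have ne: "cpoly P \<noteq> 0" using P by (rule cpoly_nonzero)
    then have "order l (cpoly P) \<noteq> 0" using l by (simp add: order_root complex_roots_def)
    then obtain n where n: "order l (cpoly P) = Suc n" by (metis not0_implies_Suc)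
    obtain q where q: "cpoly P = [:- l, 1:] ^ Suc n * q" "\<not> [:- l, 1:] dvd q"
      using order_decomp[OF ne, of l] unfolding n by blast
    define q' where "q' = smult ((- 1) ^ Suc n) (pcompose q [:0, - 1:])"
    have "poly (reflected_cpoly P) z = (z - - l) ^ Suc n * poly q' z" for z
    proof -
      have "poly (reflected_cpoly P) z = (- l - z) ^ Suc n * poly q (- z)"
      proof -
        have "poly [:- l, 1:] (- z) = - l - z" by simp
        then show ?thesis unfolding poly_reflected_cpoly q(1) poly_mult poly_power by (simp only:)
      qed
      also have "- l - z = (- 1) * (z - - l)" by simp
      also have "((- 1) * (z - - l)) ^ Suc n = (- 1) ^ Suc n * (z - - l) ^ Suc n" by (rule power_mult_distrib)
      finally show ?thesis
        by (simp add: q'_def poly_pcompose mult_ac del: power_Suc)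
    qed
    moreover have "poly q' (- l) \<noteq> 0" using q(2) by (simp add: q'_def poly_pcompose poly_eq_0_iff_dvd)
    ultimately have "residue (\<lambda>z. exp (of_real t * z) / poly (reflected_cpoly P) z) (- l)
        = (\<Sum>k\<le>n. residue (\<lambda>z. (z - - l) ^ k / poly (reflected_cpoly P) z) (- l) * of_real (t ^ k / fact k) * exp (of_real t * - l))"
      by (rule residue_exp_expansion)
    also have "\<dots> = (\<Sum>k\<le>n. laurent_coeff P l (Suc k) * of_real (t ^ k / fact k) * exp (of_real t * - l))"
      by (simp add: laurent_coeff_def poly_reflected_cpoly)
    also have "cmod \<dots> \<le> (\<Sum>k\<le>n. cmod (laurent_coeff P l (Suc k)) * (t ^ k / fact k * exp (- min_re_root P * t)))"
    proof (rule sum_norm_le)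
      fix k
      have "cmod (exp (of_real t * - l)) \<le> exp (- min_re_root P * t)"
        using mult_right_mono[OF min_re_root_le[OF P l] t] by (simp add: mult.commute)
      then have "cmod (laurent_coeff P l (Suc k)) * (t ^ k / fact k * cmod (exp (of_real t * - l)))
          \<le> cmod (laurent_coeff P l (Suc k)) * (t ^ k / fact k * exp (- min_re_root P * t))"
        using t by (intro mult_left_mono) auto
      moreover have "cmod (of_real (t ^ k / fact k)) = t ^ k / fact k"
        using t by (simp only: norm_of_real) simp
      ultimately show "cmod (laurent_coeff P l (Suc k) * of_real (t ^ k / fact k) * exp (of_real t * - l))
          \<le> cmod (laurent_coeff P l (Suc k)) * (t ^ k / fact k * exp (- min_re_root P * t))"
        by (simp only: norm_mult mult.assoc)
    qed
    also have "\<dots> = (\<Sum>k = 1..order l (cpoly P). cmod (laurent_coeff P l k) * (t ^ (k - 1) / fact (k - 1) * exp (- min_re_root P * t)))"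
      unfolding n One_nat_def sum.atLeast_Suc_atMost_Suc_shift atMost_atLeast0 by simp
    finally show "cmod (residue (\<lambda>z. exp (of_real t * z) / poly (reflected_cpoly P) z) (- l)) \<le> \<dots>" .
  qed
  finally show ?thesis .
qed

section \<open>Right linear semigroups on a two-sided module\<close>

lemma bounded_right_linearD:
  assumes mod: "banach_two_sided_module lsm rsm" and B: "B \<in> bounded_right_linear rsm"
  shows "bounded_linear B" "B (rsm x q) = rsm (B x) q"
proof -
  interpret banach_two_sided_module lsm rsm by fact
  obtain K where K: "\<And>x. norm (B x) / norm x \<le> K"
    using B by (auto simp: bounded_right_linear_def bdd_above_def)
  have add: "B (x + y) = B x + B y" for x y using B by (simp add: bounded_right_linear_def)
  show "bounded_linear B"
  proof (rule bounded_linear_intro)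
    show "B (r *\<^sub>R x) = r *\<^sub>R B x" for r x
      using B unfolding rsm_of_real[symmetric] by (simp add: bounded_right_linear_def)
    show "norm (B x) \<le> norm x * K" for x
      using K[of x] add[of 0 0] by (cases "x = 0") (auto simp: field_simps)
  qed (rule add)
  show "B (rsm x q) = rsm (B x) q" using B by (simp add: bounded_right_linear_def)
qed

lemma bounded_right_linearI:
  assumes "bounded_linear B" "\<And>x q. B (rsm x q) = rsm (B x) q"
  shows "B \<in> bounded_right_linear rsm"
  unfolding bounded_right_linear_def
  using assms(2) linear_add[OF bounded_linear.linear[OF assms(1)]] le_onorm[OF assms(1)]
  by (auto simp: bdd_above_def)

lemma bounded_linear_rsm:
  assumes "banach_two_sided_module lsm rsm"
  shows "bounded_linear (\<lambda>x. rsm x q)"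
proof -
  interpret banach_two_sided_module lsm rsm by fact
  show ?thesis
  proof (rule bounded_linear_intro)
    show "rsm (x + y) q = rsm x q + rsm y q" for x y by (rule rsm_add_left)
    show "rsm (r *\<^sub>R x) q = r *\<^sub>R rsm x q" for r x
      unfolding lsm_of_real[symmetric] by (rule lsm_rsm[symmetric])
    show "norm (rsm x q) \<le> norm x * norm q" for x using norm_rsm[of x q] by (simp add: mult.commute)
  qed
qed

lemma lsm_sum_scaleR:
  assumes "banach_two_sided_module lsm rsm" "finite I"
  shows "lsm (\<Sum>i\<in>I. r i *\<^sub>R q i) x = (\<Sum>i\<in>I. r i *\<^sub>R lsm (q i) x)"
proof -
  interpret banach_two_sided_module lsm rsm by fact
  have scale: "lsm (r *\<^sub>R q) x = r *\<^sub>R lsm q x" for r q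
    using lsm_lsm[of "of_real r" q x] lsm_of_real[of r "lsm q x"] by (simp add: of_real_def)
  show ?thesis
    using assms(2)
  proof (induction I rule: finite_induct)
    case empty
    show ?case using scale[of 0 0] by simp
  qed (simp add: lsm_add_left scale)
qed

lemma exp_bounded_semigroupI:
  assumes mod: "banach_two_sided_module lsm rsm"
    and T: "right_linear_semigroup rsm T"
    and bdd: "bdd_above ((\<lambda>t. onorm (T t) * exp (- \<omega> * t)) ` {0..})"
    and M: "M = (SUP t\<in>{0..}. onorm (T t) * exp (- \<omega> * t))"
  shows "exp_bounded_semigroup T M \<omega>" "M \<ge> 0"
proof -
  have bl: "bounded_linear (T t)" if "t \<ge> 0" for t
    using T that by (intro bounded_right_linearD(1)[OF mod]) (auto simp: right_linear_semigroup_def)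
  have le_M: "onorm (T t) * exp (- \<omega> * t) \<le> M" if "t \<ge> 0" for t
    unfolding M using bdd that by (intro cSUP_upper) auto
  show "M \<ge> 0" using le_M[of 0] onorm_pos_le[OF bl[of 0]] by simp
  show "exp_bounded_semigroup T M \<omega>"
  proof (rule exp_bounded_semigroup.intro)
    show "bounded_linear (T t)" if "t \<ge> 0" for t using that by (rule bl)
    show "continuous_on {0..} (\<lambda>t. T t x)" for x using T by (simp add: right_linear_semigroup_def)
    show "T 0 x = x" for x using T by (simp add: right_linear_semigroup_def)
    show "T (t + s) x = T t (T s x)" if "t \<ge> 0" "s \<ge> 0" for t s x
      using T that by (cases "t = 0 \<or> s = 0") (auto simp: right_linear_semigroup_def)
    show "norm (T t x) \<le> M * exp (\<omega> * t) * norm x" if t: "t \<ge> 0" for t x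
    proof -
      have "onorm (T t) = onorm (T t) * exp (- \<omega> * t) * exp (\<omega> * t)"
        by (simp add: mult.assoc exp_add[symmetric])
      also have "\<dots> \<le> M * exp (\<omega> * t)" using le_M[OF t] by (intro mult_right_mono) auto
      finally have "onorm (T t) * norm x \<le> M * exp (\<omega> * t) * norm x" by (intro mult_right_mono) auto
      then show ?thesis using onorm[OF bl[OF t], of x] by linarith
    qed
  qed
qed

theorem theorem3p4:
  fixes star :: "'a::{real_normed_algebra, real_algebra_1, banach} \<Rightarrow> 'a"
    and lsm :: "'a \<Rightarrow> 'x::banach \<Rightarrow> 'x"
    and rsm :: "'x \<Rightarrow> 'a \<Rightarrow> 'x"
    and m :: nat
    and P :: "real poly"
    and T :: "real \<Rightarrow> 'x \<Rightarrow> 'x"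
    and D :: "'x set"
    and A :: "'x \<Rightarrow> 'x"
    and \<omega> M :: real
  assumes "real_star_algebra star"
    and "\<exists>B::'a set. finite B \<and> span B = UNIV"
    and "imaginary_units star \<noteq> {}"
    and "\<forall>q\<in>quadratic_cone star. of_real ((norm q)\<^sup>2) = q * star q"
    and "banach_two_sided_module lsm rsm"
    and "degree P = m + 2"
    and "right_linear_semigroup rsm T"
    and "D = generator_dom T"
    and "\<forall>x\<in>D. A x = generator T x"
    and "bdd_above ((\<lambda>t. onorm (T t) * exp (- \<omega> * t)) ` {0..})"
    and "M = (SUP t\<in>{0..}. onorm (T t) * exp (- \<omega> * t))"
    and "min_re_root P > \<omega>"
  shows "bij_betw (poly_op P A) (op_power_dom D A (m + 2)) UNIV
    \<and> poly_op_inv P D A \<in> bounded_right_linear rsm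
    \<and> (\<lambda>t. of_real (gP m P t) :: 'a) \<in> laplace_space T
    \<and> (\<forall>x. strong_bochner_integrable (lebesgue_on {0..}) (\<lambda>t. T t (lsm (of_real (gP m P t)) x))
          \<and> poly_op_inv P D A x = laplace_op lsm T (\<lambda>t. of_real (gP m P t)) x)
    \<and> (\<forall>p :: nat \<Rightarrow> 'a.
          let g = (\<lambda>t. \<Sum>j\<le>m + 1. of_real ((half_line_deriv ^^ j) (gP m P) t * (- 1) ^ j) * p j)
          in g \<in> laplace_space T
            \<and> (\<forall>x. strong_bochner_integrable (lebesgue_on {0..}) (\<lambda>t. T t (lsm (g t) x))
                \<and> (\<Sum>j\<le>m + 1. (A ^^ j) (poly_op_inv P D A (lsm (p j) x))) = laplace_op lsm T g x))
    \<and> onorm (poly_op_inv P D A)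
        \<le> M * (\<Sum>l\<in>complex_roots P. \<Sum>k = 1..order l (cpoly P).
                 cmod (laurent_coeff P l k) / (min_re_root P - \<omega>) ^ k)"
proof -
  interpret module: banach_two_sided_module lsm rsm by fact
  interpret exp_bounded_semigroup T M \<omega>
    by (rule exp_bounded_semigroupI(1)[OF assms(5,7,10,11)])
  have M: "M \<ge> 0" by (rule exp_bounded_semigroupI(2)[OF assms(5,7,10,11)])
  \<comment> \<open>The residue bound loses an arbitrarily small part of the rate \<open>min_re_root P\<close>, so decay is measured at a rate strictly between \<open>\<omega>\<close> and \<open>min_re_root P\<close>.\<close>
  define c where "c = (\<omega> + min_re_root P) / 2"
  have c: "c > \<omega>" "c < min_re_root P" using assms(12) by (auto simp: c_def)
  have deg: "degree P > 0" "degree P = m + 2" using assms(6) by auto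
  note decay = exp_decay_fundamental_solution[OF deg(1) c(2)]
  note der = fundamental_solution_has_vector_derivative[OF deg(1)]
  have ode: "(\<Sum>k\<le>m + 2. (- 1) ^ k * coeff P k * fundamental_solution P k t) = 0" for t
    using fundamental_solution_ode[OF deg(1)] unfolding deg(2) .
  have init: "j \<le> m \<Longrightarrow> fundamental_solution P j 0 = 0" "fundamental_solution P (m + 1) 0 = (- 1) ^ m * inverse (coeff P (m + 2))" for j
    using fundamental_solution_initial[of j P] fundamental_solution_initial[of "m + 1" P] by (auto simp: deg)
  interpret resolvent_kernel T M \<omega> D A "fundamental_solution P" c P m
    by unfold_locales (use assms(8,9) c deg der decay ode init in auto)
  have gP: "(half_line_deriv ^^ j) (gP m P) t = fundamental_solution P j t" if "t \<ge> 0" for j t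
    by (rule gP_eq[OF deg(2) der ode init that])
  have gP0: "gP m P t = fundamental_solution P 0 t" if "t \<ge> 0" for t using gP[OF that, of 0] by simp
  note lin_T = bounded_linear.linear[OF bounded_linear_T]
  have B: "poly_op_inv P D A = orbit_integral (fundamental_solution P 0)" by (rule poly_op_inv_eq)
  have right_linear: "poly_op_inv P D A \<in> bounded_right_linear rsm"
    unfolding B
  proof (rule bounded_right_linearI[OF bounded_linear_orbit_integral[OF decay c(1)]])
    fix x q
    show "orbit_integral (fundamental_solution P 0) (rsm x q) = rsm (orbit_integral (fundamental_solution P 0) x) q"
      using assms(7) by (intro commute_orbit_integral[OF decay c(1) bounded_linear_rsm[OF assms(5)], symmetric]
          bounded_right_linearD(2)[OF assms(5), symmetric]) (auto simp: right_linear_semigroup_def)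
  qed
  \<comment> \<open>Both integral formulas are instances of this one: a single weight with coefficient one, and all derivatives with alternating signs.\<close>
  have laplace: "g \<in> laplace_space T \<and> (\<forall>x. strong_bochner_integrable (lebesgue_on {0..}) (\<lambda>t. T t (lsm (g t) x))
      \<and> laplace_op lsm T g x = (\<Sum>j\<in>I. r j *\<^sub>R orbit_integral (fundamental_solution P j) (lsm (q j) x)))"
    if I: "finite I" and g: "\<And>t. t \<ge> 0 \<Longrightarrow> g t = (\<Sum>j\<in>I. (r j * fundamental_solution P j t) *\<^sub>R q j)"
    for I :: "nat set" and r :: "nat \<Rightarrow> real" and q g
  proof (intro conjI allI)
    note decay' = exp_decay_cmult[OF decay]
    show "g \<in> laplace_space T"
      by (rule laplace_space_weighted_sum[OF I decay' c(1) M g])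
    fix x
    have "T t (lsm (g t) x) = (\<Sum>j\<in>I. (r j * fundamental_solution P j t) *\<^sub>R T t (lsm (q j) x))" if "t \<ge> 0" for t
      unfolding g[OF that] lsm_sum_scaleR[OF assms(5) I]
      by (simp only: linear_sum[OF lin_T[OF that]] linear_scale[OF lin_T[OF that]])
    note * = strong_bochner_integral_weighted_orbits
      [where \<phi> = "\<lambda>j t. r j * fundamental_solution P j t" and y = "\<lambda>j. lsm (q j) x", OF I decay' c(1) this]
    show "strong_bochner_integrable (lebesgue_on {0..}) (\<lambda>t. T t (lsm (g t) x))" by (rule *(1))
    show "laplace_op lsm T g x = (\<Sum>j\<in>I. r j *\<^sub>R orbit_integral (fundamental_solution P j) (lsm (q j) x))"
      by (simp only: laplace_op_def *(2) orbit_integral_cmult)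
  qed
  have "(\<lambda>t. of_real (gP m P t) :: 'a) \<in> laplace_space T
    \<and> (\<forall>x. strong_bochner_integrable (lebesgue_on {0..}) (\<lambda>t. T t (lsm (of_real (gP m P t)) x))
          \<and> poly_op_inv P D A x = laplace_op lsm T (\<lambda>t. of_real (gP m P t)) x)"
    using laplace[of "{0}" "\<lambda>t. of_real (gP m P t)" "\<lambda>_. 1" "\<lambda>_. 1"]
    by (simp add: gP0 of_real_def B module.lsm_one)
  moreover have "g \<in> laplace_space T
      \<and> (\<forall>x. strong_bochner_integrable (lebesgue_on {0..}) (\<lambda>t. T t (lsm (g t) x))
          \<and> (\<Sum>j\<le>m + 1. (A ^^ j) (poly_op_inv P D A (lsm (p j) x))) = laplace_op lsm T g x)"
    if g_def: "g = (\<lambda>t. \<Sum>j\<le>m + 1. of_real ((half_line_deriv ^^ j) (gP m P) t * (- 1) ^ j) * p j)"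
    for p :: "nat \<Rightarrow> 'a" and g
  proof -
    have "(\<Sum>j\<le>m + 1. (A ^^ j) (poly_op_inv P D A (lsm (p j) x)))
        = (\<Sum>j\<le>m + 1. (- 1) ^ j *\<^sub>R orbit_integral (fundamental_solution P j) (lsm (p j) x))" for x
      unfolding B using power_orbit_integral by (intro sum.cong refl) blast+
    moreover have "g t = (\<Sum>j\<le>m + 1. ((- 1) ^ j * fundamental_solution P j t) *\<^sub>R p j)" if "t \<ge> 0" for t
      unfolding g_def gP[OF that] by (intro sum.cong refl) (simp add: of_real_def mult.commute)
    ultimately show ?thesis
      using laplace[of "{..m + 1}" g "\<lambda>j. (- 1) ^ j" p] by (simp only: finite_atMost) simp
  qed
  moreover have "onorm (poly_op_inv P D A)
        \<le> M * (\<Sum>l\<in>complex_roots P. \<Sum>k = 1..order l (cpoly P).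
                 cmod (laurent_coeff P l k) / (min_re_root P - \<omega>) ^ k)" (is "_ \<le> M * ?K")
  proof -
    let ?r = "min_re_root P"
    let ?H = "\<lambda>t. \<Sum>l\<in>complex_roots P. \<Sum>k = 1..order l (cpoly P).
      cmod (laurent_coeff P l k) * (t ^ (k - 1) / fact (k - 1) * exp (- ?r * t))"
    have "((\<lambda>t. \<Sum>l\<in>complex_roots P. \<Sum>k = 1..order l (cpoly P).
        cmod (laurent_coeff P l k) * (t ^ (k - 1) / fact (k - 1) * exp (- (?r - \<omega>) * t))) has_integral
        (\<Sum>l\<in>complex_roots P. \<Sum>k = 1..order l (cpoly P). cmod (laurent_coeff P l k) * (1 / (?r - \<omega>) ^ Suc (k - 1)))) {0..}"
      using assms(12) by (intro has_integral_sum finite_complex_roots deg(1) has_integral_mult_right has_integral_power_exp) auto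
    moreover have "(\<Sum>l\<in>complex_roots P. \<Sum>k = 1..order l (cpoly P). cmod (laurent_coeff P l k) * (1 / (?r - \<omega>) ^ Suc (k - 1))) = ?K"
      by (intro sum.cong refl) auto
    moreover have "(\<Sum>l\<in>complex_roots P. \<Sum>k = 1..order l (cpoly P).
        cmod (laurent_coeff P l k) * (t ^ (k - 1) / fact (k - 1) * exp (- (?r - \<omega>) * t))) = ?H t * exp (\<omega> * t)" for t
    proof -
      have "exp (- (?r - \<omega>) * t) = exp (- ?r * t) * exp (\<omega> * t)"
        unfolding exp_add[symmetric] by (simp add: algebra_simps)
      then show ?thesis by (simp only: sum_distrib_right mult.assoc)
    qed
    ultimately have "((\<lambda>t. ?H t * exp (\<omega> * t)) has_integral ?K) {0..}" by simp
    from norm_orbit_integral_le[OF decay c(1) fundamental_solution_bound[OF deg(1)] this]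
    have *: "norm (orbit_integral (fundamental_solution P 0) x) \<le> (M * ?K) * norm x" for x .
    have "?K \<ge> 0" using assms(12) by (intro sum_nonneg divide_nonneg_nonneg) auto
    then show ?thesis
      unfolding B using M * by (intro onorm_bound mult_nonneg_nonneg)
  qed
  ultimately show ?thesis
    using bij_betw_poly_op right_linear unfolding Let_def by blast
qed

end
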